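(* Let $G$ be a non-discrete Hausdorff topological group. Then $\omega(G)=2-\mu(G)$, where $\omega(G)$ is the asymptotic uniform complexity and $\mu(G)$ the mean topological matching number of $G$. Moreover, $G$ is amenable if and only if $\omega(G)=1$.
   Context: Set notation: $\mathcal{P}(G)$ is the power set of $G$, $\mathcal{F}(G)$ the set of finite subsets of $G$, and $\mathcal{F}_{+}(G)=\mathcal{F}(G)\setminus\{\emptyset\}$. For $\mathcal{U},\mathcal{V}\subseteq\mathcal{P}(G)$, write $\mathcal{U}\preceq\mathcal{V}$ ("$\mathcal{V}$ refines $\mathcal{U}$") if every $V\in\mathcal{V}$ is contained in some $U\in\mathcal{U}$; put $\mathcal{U}\vee\mathcal{V}=\{U\cap V\mid U\in\mathcal{U},V\in\mathcal{V}\}$ and, for $g\in G$, $g(\mathcal{V})=\{gV\mid V\in\mathcal{V}\}$. Right uniformity: for a topological group $G$, $G_r$ denotes $G$ regarded as a uniform space whose uniform coverings are exactly those $\mathcal{U}\subseteq\mathcal{P}(G)$ for which there is a neighborhood $V$ of the neutral element with $\mathcal{U}\preceq\{Vx\mid x\in G\}$. $\mathcal{N}(G_r)$ is the set of finite uniform coverings of $G_r$. A function $f\colon G\to\mathbb{R}$ is uniformly continuous on $G_r$ if $\{f^{-1}(U)\mid U\in\mathcal{U}\}$ is a uniform covering of $G_r$ for each uniform covering $\mathcal{U}$ of $\mathbb{R}$ (i.e. each $\mathcal{U}\subseteq\mathcal{P}(\mathbb{R})$ refined by the set of all open balls of some radius $r>0$). $UC_b(G_r)$ is the space of bounded uniformly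 continuous functions $G_r\to\mathbb{R}$. Amenability: for $g\in G$ let $\lambda_G(g)\colon G\to G$, $x\mapsto gx$. $G$ is amenable if there is a linear map $m\colon UC_b(G_r)\to\mathbb{R}$ with $\inf_{x\in G} f(x)\leq m(f)\leq\sup_{x\in G} f(x)$ and $m(f\circ\lambda_G(g))=m(f)$ for all $f\in UC_b(G_r)$ and $g\in G$. For $\mathcal{U}\in\mathcal{N}(G_r)$, $N(\mathcal{U})=\inf\{|\mathcal{V}|\mid\mathcal{V}\in\mathcal{N}(G_r),\ \mathcal{U}\preceq\mathcal{V}\}$. The asymptotic uniform complexity of $G$ is $$\omega(G)=\sup_{E\in\mathcal{F}(G)}\ \sup_{\mathcal{U}\in\mathcal{N}(G_r)}\ \inf\left\{\sup_{g\in E}\frac{N(\mathcal{V}\vee g(\mathcal{V}))}{N(\mathcal{V})}\ \middle|\ \mathcal{V}\in\mathcal{N}(G_r),\ \mathcal{U}\preceq\mathcal{V}\right\}.$$ For $E,F\in\mathcal{F}(G)$ and $\mathcal{U}\subseteq\mathcal{P}(G)$, $\mu(E,F,\mathcal{U})$ is the maximum of $|D|$ over all injective maps $\phi\colon D\to F$ with $D\subseteq E$ such that for each $x\in D$ there is $U\in\mathcal{U}$ with $\{x,\phi(x)\}\subseteq U$. The mean topological matching number of $G$ is $$\mu(G)=\inf_{E\in\mathcal{F}(G)}\ \inf_{\mathcal{U}\in\mathcal{N}(G_r)}\ \sup_{F\in\mathcal{F}_{+}(G)}\ \inf_{g\in E}\frac{\mu(F,gF,\mathcal{U})}{|F|}.$$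 (Empty suprema/infima are taken in the extended reals; $E=\emptyset$ does not affect these quantities.) *)

theory Defs
  imports "HOL-Analysis.Analysis"
begin

text \<open>
  Topological groups are rendered by the type class \<open>topological_group_add\<close>. Its operation is
  written additively but is not assumed to be commutative: the product \<open>x y\<close>, the
  neutral element and the inverse of \<open>x\<close> become \<open>x + y\<close>, \<open>0\<close> and \<open>- x\<close>. The class assumes neither
  the Hausdorff property nor non-discreteness.
\<close>

text \<open>\<open>refined_by \<U> \<V>\<close> means that \<open>\<V>\<close> refines \<open>\<U>\<close>.\<close>

definition refined_by :: "'a set set \<Rightarrow> 'a set set \<Rightarrow> bool"  (infix \<open>\<preceq>\<close> 50)
  where "\<U> \<preceq> \<V> \<longleftrightarrow> (\<forall>V\<in>\<V>. \<exists>U\<in>\<U>. V \<subseteq> U)"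

definition join_cover :: "'a set set \<Rightarrow> 'a set set \<Rightarrow> 'a set set"
  where "join_cover \<U> \<V> = {U \<inter> V | U V. U \<in> \<U> \<and> V \<in> \<V>}"

definition ltranslate :: "'a::group_add \<Rightarrow> 'a set \<Rightarrow> 'a set"
  where "ltranslate g V = (\<lambda>x. g + x) ` V"

definition rtranslate :: "'a::group_add set \<Rightarrow> 'a \<Rightarrow> 'a set"
  where "rtranslate V x = (\<lambda>v. v + x) ` V"

text \<open>
  The right uniformity, given by its uniform coverings. Neighborhoods of \<open>0\<close> need not be open.
\<close>

definition right_uniform_cover :: "'a::topological_group_add set set \<Rightarrow> bool"
  where "right_uniform_cover \<U> \<longleftrightarrow>
    (\<exists>V. (\<forall>\<^sub>F x in nhds 0. x \<in> V) \<and> \<U> \<preceq> range (rtranslate V))"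

definition fin_uniform_covers :: "'a::topological_group_add set set set"
  where "fin_uniform_covers = {\<U>. finite \<U> \<and> right_uniform_cover \<U>}"

definition real_uniform_cover :: "real set set \<Rightarrow> bool"
  where "real_uniform_cover \<U> \<longleftrightarrow> (\<exists>r>0. \<U> \<preceq> range (\<lambda>x. ball x r))"

definition right_uniformly_continuous :: "('a::topological_group_add \<Rightarrow> real) \<Rightarrow> bool"
  where "right_uniformly_continuous f \<longleftrightarrow>
    (\<forall>\<U>. real_uniform_cover \<U> \<longrightarrow> right_uniform_cover {f -` U | U. U \<in> \<U>})"

definition UC_b :: "('a::topological_group_add \<Rightarrow> real) set"
  where "UC_b = {f. bounded (range f) \<and> right_uniformly_continuous f}"

text \<open>
  The mean \<open>m\<close> is a total function of which only the values on \<open>UC_b\<close> matter; linearity is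
  required on that subspace. For bounded \<open>f\<close> the real infimum and supremum below are genuine.
\<close>

definition amenable :: "'a::topological_group_add itself \<Rightarrow> bool"
  where "amenable _ \<longleftrightarrow>
    (\<exists>m :: ('a \<Rightarrow> real) \<Rightarrow> real.
      (\<forall>f\<in>UC_b. \<forall>h\<in>UC_b. m (\<lambda>x. f x + h x) = m f + m h) \<and>
      (\<forall>c. \<forall>f\<in>UC_b. m (\<lambda>x. c * f x) = c * m f) \<and>
      (\<forall>f\<in>UC_b. (INF x. f x) \<le> m f \<and> m f \<le> (SUP x. f x)) \<and>
      (\<forall>f\<in>UC_b. \<forall>g. m (f \<circ> (\<lambda>x. g + x)) = m f))"

text \<open>For \<open>\<U>\<close> in \<open>fin_uniform_covers\<close> the infimum is over a nonempty set, as \<open>\<U> \<preceq> \<U>\<close>.\<close>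

definition cover_number :: "'a::topological_group_add set set \<Rightarrow> nat"
  where "cover_number \<U> = (INF \<V>\<in>{\<V> \<in> fin_uniform_covers. \<U> \<preceq> \<V>}. card \<V>)"

definition asymptotic_uniform_complexity :: "'a::topological_group_add itself \<Rightarrow> ereal"
  where "asymptotic_uniform_complexity _ =
    (SUP E \<in> {E :: 'a set. finite E}. SUP \<U> \<in> fin_uniform_covers.
      INF \<V> \<in> {\<V> \<in> fin_uniform_covers. \<U> \<preceq> \<V>}.
        SUP g\<in>E. ereal (real (cover_number (join_cover \<V> (ltranslate g ` \<V>)))
                        / real (cover_number \<V>)))"

definition matching_number :: "'a set \<Rightarrow> 'a set \<Rightarrow> 'a set set \<Rightarrow> nat"
  where "matching_number E F \<U> =
    Max {card D | D \<phi>. D \<subseteq> E \<and> inj_on \<phi> D \<and> \<phi> ` D \<subseteq> F \<and>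
                       (\<forall>x\<in>D. \<exists>U\<in>\<U>. {x, \<phi> x} \<subseteq> U)}"

definition mean_topological_matching_number :: "'a::topological_group_add itself \<Rightarrow> ereal"
  where "mean_topological_matching_number _ =
    (INF E \<in> {E :: 'a set. finite E}. INF \<U> \<in> fin_uniform_covers.
      SUP F \<in> {F. finite F \<and> F \<noteq> {}}.
        INF g\<in>E. ereal (real (matching_number F (ltranslate g F) \<U>) / real (card F)))"

end

theory Submission
  imports Defs
begin

text \<open>
  Write \<open>N(\<V>)\<close> for the covering number, \<open>\<mu>\<close> for the mean topological matching number and \<open>\<omega>\<close> for
  the asymptotic uniform complexity. Two facts are combined: \<open>\<omega> = 2 - \<mu>\<close>, and amenability is
  equivalent to \<open>\<mu> = 1\<close>.

  \<^bold>\<open>Coverings give matchings\<close> (\<open>matching_from_cover\<close>). Suppose that \<open>\<V>\<close> is a fine finite uniform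
  covering, let \<open>\<A>\<close> be a smallest refinement of \<open>\<V>\<close> and \<open>\<C>\<close> a smallest refinement of \<open>\<V> \<or> g(\<V>)\<close>. By
  an exchange argument and Hall's theorem, \<open>\<A>\<close> and also \<open>g(\<A>)\<close> inject into \<open>\<C>\<close> in such a way that
  corresponding members meet. The two images overlap in at least \<open>2 N(\<V>) - N(\<V> \<or> g(\<V>))\<close> members of
  \<open>\<C>\<close>, and each of them links a member of \<open>\<A>\<close> to a member of \<open>g(\<A>)\<close>. Choosing one point in each
  member of \<open>\<A>\<close> gives a set \<open>F\<close> with a matching of this size between \<open>F\<close> and \<open>g + F\<close>, whence
  \<open>\<mu> \<ge> 2 - \<omega>\<close>.

  \<^bold>\<open>Matchings give coverings\<close> (\<open>cover_from_matching\<close>). Given a finite set \<open>F\<close>, replace each of its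
  points by many nearby points, in general position. Then take the covering that has one member per
  point, such that no other member contains this point, together with boundedly many members for
  the rest of the group. Its covering number is essentially the number of points. In \<open>\<V> \<or> g(\<V>)\<close> the
  points and their translates have to be covered, and one member suffices for both points of a
  matched pair. This yields \<open>\<omega> \<le> 2 - \<mu>\<close>.

  \<^bold>\<open>Means give matchings\<close> (\<open>mean_imp_matching\<close>). An invariant mean vanishes on the functions
  \<open>f(g + x) - f(x)\<close> with \<open>f\<close> in \<open>UC_b\<close>. For finitely many of these, choosing points one after the other
  such that the vector of the sums of these functions never gains much length produces a finite set
  \<open>F\<close> whose averages are almost invariant (\<open>approximately_invariant_set\<close>). Uniformly continuous
  Urysohn functions then verify Hall's condition, with a small defect, for matching \<open>F\<close> with \<open>g + F\<close>.

  \<^bold>\<open>Matchings give means\<close> (\<open>approximately_invariant_imp_mean\<close>). If \<open>F\<close> is almost matched with \<open>g + F\<close>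
  along a covering on which \<open>f\<close> oscillates little, then the averages of \<open>f\<close> over \<open>F\<close> and \<open>g + F\<close>
  almost agree. A limit of such averages, obtained from Tychonoff's theorem, is an invariant mean.

  The first three steps choose finite sets of distinct points in prescribed open sets. This is
  possible because nonempty open sets are infinite, which is where non-discreteness and the
  Hausdorff property enter.
\<close>

section \<open>Neighborhoods in a topological group\<close>

lemma open_ltranslate_vimage:
  fixes S :: "'a::topological_group_add set"
  assumes "open S"
  shows "open {x. g + x \<in> S}"
proof -
  have "open ((\<lambda>x. g + x) -` S)"
    by (intro open_vimage assms continuous_intros)
  then show ?thesis by (simp add: vimage_def)
qed

lemma open_rtranslate_vimage:
  fixes S :: "'a::topological_group_add set"
  assumes "open S"
  shows "open {x. x + g \<in> S}"
proof -
  have "open ((\<lambda>x. x + g) -` S)"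
    by (intro open_vimage assms continuous_intros)
  then show ?thesis by (simp add: vimage_def)
qed

lemma nbhd_zero_sum3:
  fixes S :: "'a::topological_group_add set"
  assumes "open S" "0 \<in> S"
  obtains P where "open P" "0 \<in> P" "\<And>p. p \<in> P \<Longrightarrow> - p \<in> P"
    "\<And>a b c. a \<in> P \<Longrightarrow> b \<in> P \<Longrightarrow> c \<in> P \<Longrightarrow> a + b + c \<in> S"
proof -
  have "((\<lambda>p. fst p + fst (snd p) + snd (snd p)) \<longlongrightarrow> 0 + 0 + (0::'a)) (nhds 0 \<times>\<^sub>F (nhds 0 \<times>\<^sub>F nhds 0))"
    by (intro tendsto_add) (auto intro: filterlim_compose[OF _ filterlim_fst] filterlim_compose[OF _ filterlim_snd] filterlim_fst filterlim_snd)
  then have "\<forall>\<^sub>F p in (nhds 0 \<times>\<^sub>F (nhds 0 \<times>\<^sub>F nhds 0)). fst p + fst (snd p) + snd (snd p) \<in> S"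
    using assms by (auto simp: tendsto_def)
  from eventually_prod_filter[THEN iffD1, OF this]
  obtain A B where A: "eventually A (nhds 0)" and B: "eventually B (nhds 0 \<times>\<^sub>F nhds 0)"
    and AB: "\<And>x y. A x \<Longrightarrow> B y \<Longrightarrow> x + fst y + snd y \<in> S"
    by auto
  from B obtain C D where C: "eventually C (nhds 0)" and D: "eventually D (nhds 0)"
    and CD: "\<And>x y. C x \<Longrightarrow> D y \<Longrightarrow> B (x, y)"
    using eventually_prod_filter[THEN iffD1, OF B] by auto
  have "\<forall>\<^sub>F x in nhds 0. A x \<and> C x \<and> D x"
    using A C D by eventually_elim auto
  then obtain Q where Q: "open Q" "0 \<in> Q" "\<And>x. x \<in> Q \<Longrightarrow> A x \<and> C x \<and> D x"
    unfolding eventually_nhds by auto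
  have "open (uminus -` Q)"
    by (intro open_vimage Q continuous_intros)
  then show ?thesis
    using Q AB CD
    by (intro that[of "Q \<inter> uminus -` Q"]) force+
qed

lemma nbhd_sum2:
  fixes S :: "'a::topological_group_add set"
  assumes "open S" "x \<in> S"
  obtains P where "open P" "0 \<in> P" "\<And>p. p \<in> P \<Longrightarrow> - p \<in> P"
    "\<And>a b. a \<in> P \<Longrightarrow> b \<in> P \<Longrightarrow> a + b + x \<in> S"
proof -
  have "open {y. y + x \<in> S}" "0 \<in> {y. y + x \<in> S}"
    using assms open_rtranslate_vimage by auto
  from nbhd_zero_sum3[OF this] obtain P where P: "open P" "0 \<in> P" "\<And>p. p \<in> P \<Longrightarrow> - p \<in> P"
    "\<And>a b c. a \<in> P \<Longrightarrow> b \<in> P \<Longrightarrow> c \<in> P \<Longrightarrow> a + b + c \<in> {y. y + x \<in> S}"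
    by blast
  have "a + b + x \<in> S" if "a \<in> P" "b \<in> P" for a b
    using P(4)[OF P(2) that] by simp
  then show ?thesis using P that by blast
qed

lemma nondiscrete_open_infinite:
  fixes S :: "'a::{topological_group_add, t2_space} set"
  assumes nd: "\<not> (\<forall>A :: 'a set. open A)"
    and S: "open S" "x \<in> S"
  shows "infinite S"
proof
  assume "finite S"
  then have "open (S - (S - {x}))"
    using S by (intro open_Diff finite_imp_closed) auto
  moreover have "S - (S - {x}) = {x}" using S by auto
  ultimately have ox: "open {x}" by simp
  have "open {y}" for y :: 'a
  proof -
    have "open {z. x - y + z \<in> {x}}"
      by (rule open_ltranslate_vimage[OF ox])
    moreover have "{z. x - y + z \<in> {x}} = {y}"
    proof -
      have "x - y + z = x \<longleftrightarrow> z = y" for z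
      proof
        assume "x - y + z = x"
        then have "x + (- y + z) = x + 0" by (simp add: diff_conv_add_uminus add.assoc del: add_uminus_conv_diff)
        then have "- y + z = 0" by (metis add_left_cancel)
        then show "z = y" by (metis add.right_neutral add_minus_cancel)
      qed simp
      then show ?thesis by auto
    qed
    ultimately show ?thesis by simp
  qed
  then have "open (\<Union>y\<in>A. {y})" for A :: "'a set" by (intro open_UN) auto
  then show False using nd by simp
qed

section \<open>Finite uniform coverings\<close>

text \<open>
  The pointwise form in which the uniformity is used throughout: one open neighborhood \<open>V\<close> of \<open>0\<close>
  serves all points.
\<close>

lemma right_uniform_cover_iff:
  "right_uniform_cover \<U> \<longleftrightarrow>
    (\<exists>V. open V \<and> 0 \<in> V \<and> (\<forall>x. \<exists>U\<in>\<U>. \<forall>v\<in>V. v + x \<in> U))" (is "_ \<longleftrightarrow> ?R")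
proof
  assume "right_uniform_cover \<U>"
  then obtain V where V: "\<forall>\<^sub>F x in nhds 0. x \<in> V" "\<U> \<preceq> range (rtranslate V)"
    unfolding right_uniform_cover_def by blast
  then obtain W where W: "open W" "0 \<in> W" "W \<subseteq> V"
    by (auto simp: eventually_nhds)
  have "\<exists>U\<in>\<U>. \<forall>v\<in>W. v + x \<in> U" for x
  proof -
    obtain U where "U \<in> \<U>" "rtranslate V x \<subseteq> U"
      using V(2) unfolding refined_by_def by blast
    then show ?thesis
      using W(3) by (intro bexI[of _ U]) (auto simp: rtranslate_def)
  qed
  then show ?R using W by blast
next
  assume ?R
  then obtain V where "open V" "0 \<in> V" "\<forall>x. \<exists>U\<in>\<U>. \<forall>v\<in>V. v + x \<in> U" by blast
  then show "right_uniform_cover \<U>"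
    unfolding right_uniform_cover_def refined_by_def rtranslate_def
    by (intro exI[of _ V]) (auto simp: eventually_nhds image_subset_iff)
qed

lemma fin_uniform_coversI:
  assumes "finite \<U>" "open V" "0 \<in> V" "\<And>x. \<exists>U\<in>\<U>. \<forall>v\<in>V. v + x \<in> U"
  shows "\<U> \<in> fin_uniform_covers"
  using assms unfolding fin_uniform_covers_def right_uniform_cover_iff by blast

lemma fin_uniform_coversE:
  assumes "\<U> \<in> fin_uniform_covers"
  obtains V where "finite \<U>" "open V" "0 \<in> V" "\<And>x. \<exists>U\<in>\<U>. \<forall>v\<in>V. v + x \<in> U"
  using assms unfolding fin_uniform_covers_def right_uniform_cover_iff by blast

lemma fin_uniform_covers_covers:
  assumes "\<U> \<in> fin_uniform_covers"
  shows "\<exists>U\<in>\<U>. x \<in> U"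
  using fin_uniform_coversE[OF assms] by (metis add_0)

lemma refined_by_refl: "\<U> \<preceq> \<U>"
  by (auto simp: refined_by_def)

lemma refined_by_trans: "\<U> \<preceq> \<V> \<Longrightarrow> \<V> \<preceq> \<W> \<Longrightarrow> \<U> \<preceq> \<W>"
  unfolding refined_by_def by (meson order_trans)

lemma join_cover_refines: "\<U> \<preceq> join_cover \<U> \<V>" "\<V> \<preceq> join_cover \<U> \<V>"
  by (auto simp: refined_by_def join_cover_def)

lemma join_cover_least: "\<U> \<preceq> \<W> \<Longrightarrow> \<V> \<preceq> \<W> \<Longrightarrow> join_cover \<U> \<V> \<preceq> \<W>"
  unfolding refined_by_def join_cover_def by clarsimp (metis Int_greatest)

lemma join_cover_fin_uniform:
  assumes "\<U> \<in> fin_uniform_covers" "\<V> \<in> fin_uniform_covers"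
  shows "join_cover \<U> \<V> \<in> fin_uniform_covers"
proof -
  obtain O1 where O1: "finite \<U>" "open O1" "0 \<in> O1" "\<And>x. \<exists>U\<in>\<U>. \<forall>v\<in>O1. v + x \<in> U"
    using fin_uniform_coversE[OF assms(1)] by blast
  obtain O2 where O2: "finite \<V>" "open O2" "0 \<in> O2" "\<And>x. \<exists>U\<in>\<V>. \<forall>v\<in>O2. v + x \<in> U"
    using fin_uniform_coversE[OF assms(2)] by blast
  have eq: "join_cover \<U> \<V> = (\<lambda>(U, V). U \<inter> V) ` (\<U> \<times> \<V>)"
    by (auto simp: join_cover_def)
  show ?thesis
  proof (rule fin_uniform_coversI[of _ "O1 \<inter> O2"])
    show "finite (join_cover \<U> \<V>)" using O1 O2 by (simp add: eq)
    fix x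
    obtain U V where "U \<in> \<U>" "\<forall>v\<in>O1. v + x \<in> U" "V \<in> \<V>" "\<forall>v\<in>O2. v + x \<in> V"
      using O1 O2 by meson
    then show "\<exists>U\<in>join_cover \<U> \<V>. \<forall>v\<in>O1 \<inter> O2. v + x \<in> U"
      by (intro bexI[of _ "U \<inter> V"]) (auto simp: join_cover_def)
  qed (use O1(2,3) O2(2,3) in auto)
qed

lemma UNIV_fin_uniform_cover: "{UNIV} \<in> fin_uniform_covers"
  by (rule fin_uniform_coversI[of _ UNIV]) auto

lemma common_refinement:
  assumes "finite \<S>" "\<S> \<subseteq> fin_uniform_covers"
  shows "\<exists>\<W>\<in>fin_uniform_covers. \<forall>\<U>\<in>\<S>. \<U> \<preceq> \<W>"
  using assms
proof (induction \<S>)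
  case empty
  then show ?case using UNIV_fin_uniform_cover by auto
next
  case (insert \<U> \<S>)
  then obtain \<W> where "\<W> \<in> fin_uniform_covers" "\<forall>\<U>\<in>\<S>. \<U> \<preceq> \<W>" by auto
  then show ?case
    using insert.prems
    by (intro bexI[of _ "join_cover \<U> \<W>"])
       (auto intro: join_cover_refines join_cover_fin_uniform refined_by_trans[OF _ join_cover_refines(2)])
qed

lemma mem_ltranslate [simp]: "x \<in> ltranslate g V \<longleftrightarrow> - g + x \<in> V"
  unfolding ltranslate_def by (metis (no_types, lifting) image_iff add_minus_cancel minus_add_cancel)

lemma ltranslate_ltranslate: "ltranslate g (ltranslate h V) = ltranslate (g + h) V"
  by (auto simp: minus_add add.assoc simp del: add_uminus_conv_diff)

lemma ltranslate_mono: "A \<subseteq> B \<Longrightarrow> ltranslate g A \<subseteq> ltranslate g B"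
  by auto

lemma ltranslate_inverse: "ltranslate (- g) (ltranslate g V) = V" "ltranslate g (ltranslate (- g) V) = V"
  by (simp_all add: ltranslate_ltranslate set_eq_iff)

lemma card_ltranslate: "card (ltranslate g F) = card F"
  unfolding ltranslate_def by (intro card_image) auto

lemma finite_ltranslate: "finite F \<Longrightarrow> finite (ltranslate g F)"
  unfolding ltranslate_def by auto

lemma open_ltranslate:
  fixes S :: "'a::topological_group_add set"
  shows "open S \<Longrightarrow> open (ltranslate g S)"
  using open_ltranslate_vimage[of S "- g"] by (simp add: ltranslate_def[symmetric] Collect_mem_eq flip: mem_ltranslate)

lemma inj_ltranslate: "inj (ltranslate g)"
  by (metis injI ltranslate_inverse(1))

text \<open>
  The right uniformity is invariant under left translations as well, because the conjugate of a
  neighborhood of \<open>0\<close> is a neighborhood of \<open>0\<close>.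
\<close>

lemma ltranslate_fin_uniform:
  assumes "\<U> \<in> fin_uniform_covers"
  shows "ltranslate g ` \<U> \<in> fin_uniform_covers"
proof -
  obtain V where V: "finite \<U>" "open V" "0 \<in> V" "\<And>x. \<exists>U\<in>\<U>. \<forall>v\<in>V. v + x \<in> U"
    using fin_uniform_coversE[OF assms(1)] by blast
  have "open {x. - g + x \<in> {y. y + g \<in> V}}"
    by (intro open_ltranslate_vimage open_rtranslate_vimage V)
  then have op: "open {x. - g + x + g \<in> V}" by simp
  show ?thesis
  proof (rule fin_uniform_coversI[OF _ op])
    fix x
    obtain U where U: "U \<in> \<U>" "\<forall>v\<in>V. v + (- g + x) \<in> U" using V by blast
    have "- g + (v + x) \<in> U" if "- g + v + g \<in> V" for v
      using U(2)[rule_format, OF that] by (simp add: add.assoc)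
    then show "\<exists>U\<in>ltranslate g ` \<U>. \<forall>v\<in>{x. - g + x + g \<in> V}. v + x \<in> U"
      using U(1) by auto
  qed (use V(1,3) in auto)
qed

lemma ltranslate_refined_by: "\<U> \<preceq> \<V> \<Longrightarrow> ltranslate g ` \<U> \<preceq> ltranslate g ` \<V>"
  unfolding refined_by_def by (metis (no_types, opaque_lifting) image_iff ltranslate_mono)

lemma translates_common_refinement:
  assumes "\<U> \<in> fin_uniform_covers" "finite E"
  obtains \<W> where "\<W> \<in> fin_uniform_covers" "\<U> \<preceq> \<W>" "\<And>g. g \<in> E \<Longrightarrow> ltranslate g ` \<U> \<preceq> \<W>"
proof -
  let ?S = "insert \<U> ((\<lambda>g. ltranslate g ` \<U>) ` E)"
  have "\<exists>\<W>\<in>fin_uniform_covers. \<forall>\<V>\<in>?S. \<V> \<preceq> \<W>"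
    using assms ltranslate_fin_uniform by (intro common_refinement) auto
  then show ?thesis using that by auto
qed

lemma interior_fin_uniform:
  assumes "\<U> \<in> fin_uniform_covers"
  shows "interior ` \<U> \<in> fin_uniform_covers"
proof -
  obtain V where V: "finite \<U>" "open V" "0 \<in> V" "\<And>x. \<exists>U\<in>\<U>. \<forall>v\<in>V. v + x \<in> U"
    using fin_uniform_coversE[OF assms(1)] by blast
  show ?thesis
  proof (rule fin_uniform_coversI[OF _ V(2,3)])
    fix x
    obtain U where U: "U \<in> \<U>" "\<forall>v\<in>V. v + x \<in> U" using V by blast
    have "open {y. y + - x \<in> V}" by (rule open_rtranslate_vimage[OF V(2)])
    moreover have "{y. y + - x \<in> V} \<subseteq> U"
      using U by force
    ultimately have "{y. y + - x \<in> V} \<subseteq> interior U" by (rule interior_maximal[rotated])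
    then have "\<forall>v\<in>V. v + x \<in> interior U" by (auto simp: subset_eq)
    then show "\<exists>U\<in>interior ` \<U>. \<forall>v\<in>V. v + x \<in> U" using U(1) by blast
  qed (use V(1,3) in auto)
qed

lemma interior_refines: "\<U> \<preceq> interior ` \<U>"
  unfolding refined_by_def using interior_subset by blast

text \<open>
  Star refinements exist within the \<^emph>\<open>finite\<close> uniform coverings. Record for each point \<open>x\<close> its
  profile, i.e. which of the neighborhoods \<open>P + x\<close>, \<open>P + P + x\<close> and \<open>P + P + P + x\<close> lie in which
  members of \<open>\<U>\<close>. There are only finitely many profiles, and the \<open>P\<close>-neighborhoods of the profile
  classes are the required covering: each step by an element of \<open>P\<close> costs one level of the profile
  and a step inside a profile class costs none, so three steps of the first kind, starting from
  level three, stay in the given member of \<open>\<U>\<close>.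
\<close>

lemma star_refinement:
  assumes "\<U> \<in> fin_uniform_covers"
  obtains \<W> where "\<W> \<in> fin_uniform_covers" "\<U> \<preceq> \<W>"
    "\<And>W. W \<in> \<W> \<Longrightarrow> \<exists>U\<in>\<U>. \<forall>W'\<in>\<W>. W \<inter> W' \<noteq> {} \<longrightarrow> W \<union> W' \<subseteq> U"
proof -
  obtain V where V: "finite \<U>" "open V" "0 \<in> V" "\<And>x. \<exists>U\<in>\<U>. \<forall>v\<in>V. v + x \<in> U"
    using fin_uniform_coversE[OF assms(1)] by blast
  obtain P where P: "open P" "0 \<in> P" "\<And>p. p \<in> P \<Longrightarrow> - p \<in> P"
    "\<And>a b c. a \<in> P \<Longrightarrow> b \<in> P \<Longrightarrow> c \<in> P \<Longrightarrow> a + b + c \<in> V"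
    using nbhd_zero_sum3[OF V(2,3)] by blast
  define l3 where "l3 x = {U\<in>\<U>. \<forall>a\<in>P. \<forall>b\<in>P. \<forall>c\<in>P. a + (b + (c + x)) \<in> U}" for x
  define l2 where "l2 x = {U\<in>\<U>. \<forall>a\<in>P. \<forall>b\<in>P. a + (b + x) \<in> U}" for x
  define l1 where "l1 x = {U\<in>\<U>. \<forall>a\<in>P. a + x \<in> U}" for x
  define pr where "pr x = (l3 x, l2 x, l1 x)" for x
  define B where "B x = {y. \<exists>p\<in>P. \<exists>z. pr z = pr x \<and> y = p + z}" for x
  have l3: "\<exists>U. U \<in> l3 x" for x
    using V(4)[of x] P(4) unfolding l3_def by (fastforce simp: add.assoc)
  have l32: "l3 x \<subseteq> l2 (p + x)" if "p \<in> P" for p x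
    using that unfolding l3_def l2_def by blast
  have l21: "l2 x \<subseteq> l1 (p + x)" if "p \<in> P" for p x
    using that unfolding l1_def l2_def by blast
  have l23: "l3 x \<subseteq> l2 x" for x using l32[OF P(2), of x] by simp
  have l12: "l2 x \<subseteq> l1 x" for x using l21[OF P(2), of x] by simp
  define \<W> where "\<W> = range B"
  have near: "\<exists>U\<in>\<U>. \<forall>W'\<in>\<W>. W \<inter> W' \<noteq> {} \<longrightarrow> W \<union> W' \<subseteq> U" if W: "W \<in> \<W>" for W
  proof -
    obtain x where x: "W = B x" using W by (auto simp: \<W>_def)
    obtain U where U: "U \<in> l3 x" using l3 by blast
    have in2: "U \<in> l2 y" if "y \<in> W" for y
      using that U l32 unfolding x B_def pr_def by fastforce
    have in0: "y \<in> U" if "y \<in> W" for y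
    proof -
      have "U \<in> l1 y" using in2[OF that] l12 by blast
      then show ?thesis using P(2) unfolding l1_def by force
    qed
    have "y \<in> U" if W': "W' \<in> \<W>" "w \<in> W" "w \<in> W'" "y \<in> W'" for W' w y
    proof -
      obtain x' where x': "W' = B x'" using W' by (auto simp: \<W>_def)
      obtain p z where pz: "p \<in> P" "pr z = pr x'" "w = p + z" using W' x' unfolding B_def by blast
      obtain q z' where qz: "q \<in> P" "pr z' = pr x'" "y = q + z'" using W' x' unfolding B_def by blast
      have "U \<in> l2 w" using in2 W' by blast
      then have "U \<in> l1 (- p + w)" using l21[of "- p"] P(3)[OF pz(1)] by blast
      then have "U \<in> l1 z" by (simp add: pz)
      then have "U \<in> l1 z'" using pz qz by (simp add: pr_def)
      then show ?thesis using qz by (simp add: l1_def)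
    qed
    moreover have "U \<in> \<U>" using U by (simp add: l3_def)
    ultimately show ?thesis using in0 by (intro bexI[of _ U]) blast+
  qed
  have fin: "finite \<W>"
  proof -
    have "range pr \<subseteq> Pow \<U> \<times> Pow \<U> \<times> Pow \<U>" by (auto simp: pr_def l1_def l2_def l3_def)
    then have "finite (range pr)" by (rule finite_subset) (use V(1) in auto)
    moreover have "\<W> \<subseteq> (\<lambda>q. {y. \<exists>p\<in>P. \<exists>z. pr z = q \<and> y = p + z}) ` range pr"
      by (auto simp: \<W>_def B_def)
    ultimately show ?thesis by (meson finite_imageI finite_subset)
  qed
  have "\<W> \<in> fin_uniform_covers"
    by (rule fin_uniform_coversI[OF fin P(1,2)]) (auto simp: \<W>_def B_def)
  moreover have "\<U> \<preceq> \<W>"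
    unfolding refined_by_def
  proof
    fix W assume W: "W \<in> \<W>"
    obtain U where "U \<in> \<U>" "\<forall>W'\<in>\<W>. W \<inter> W' \<noteq> {} \<longrightarrow> W \<union> W' \<subseteq> U" using near[OF W] by blast
    then show "\<exists>U\<in>\<U>. W \<subseteq> U" using W by (cases "W = {}") blast+
  qed
  ultimately show ?thesis using near that by blast
qed

section \<open>Covering numbers\<close>

lemma cover_number_attained:
  assumes "\<U> \<in> fin_uniform_covers"
  obtains \<V> where "\<V> \<in> fin_uniform_covers" "\<U> \<preceq> \<V>" "card \<V> = cover_number \<U>"
proof -
  have "cover_number \<U> \<in> card ` {\<V> \<in> fin_uniform_covers. \<U> \<preceq> \<V>}"
    unfolding cover_number_def using assms refined_by_refl by (intro Inf_nat_def1) blast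
  then show ?thesis using that by auto
qed

lemma cover_number_le:
  "\<V> \<in> fin_uniform_covers \<Longrightarrow> \<U> \<preceq> \<V> \<Longrightarrow> cover_number \<U> \<le> card \<V>"
  unfolding cover_number_def by (intro cINF_lower) auto

lemma cover_number_pos:
  assumes "\<U> \<in> fin_uniform_covers"
  shows "cover_number \<U> > 0"
proof -
  obtain \<V> where \<V>: "\<V> \<in> fin_uniform_covers" "\<U> \<preceq> \<V>" "card \<V> = cover_number \<U>"
    using cover_number_attained[OF assms] by blast
  then have "\<V> \<noteq> {}" "finite \<V>"
    using fin_uniform_covers_covers[of \<V>] by (auto simp: fin_uniform_covers_def)
  then show ?thesis using \<V> by (metis card_gt_0_iff)
qed

section \<open>Hall's theorem\<close>

text \<open>
  Induction on \<open>card A\<close>. If some proper nonempty subset \<open>S\<close> is tight, match \<open>S\<close> first and then its complement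
  into what is left. Otherwise every proper nonempty subset has a neighbor to spare, and an arbitrary
  choice for one element preserves Hall's condition for the others.
\<close>

theorem hall:
  fixes N :: "'a \<Rightarrow> 'b set"
  assumes "finite A" "\<And>x. x \<in> A \<Longrightarrow> finite (N x)"
    and "\<And>S. S \<subseteq> A \<Longrightarrow> card S \<le> card (\<Union>x\<in>S. N x)"
  shows "\<exists>f. inj_on f A \<and> (\<forall>x\<in>A. f x \<in> N x)"
  using assms
proof (induction "card A" arbitrary: A N rule: less_induct)
  case (less A N)
  note fin = less.prems(1) and finN = less.prems(2) and H = less.prems(3)
  have finU: "finite (\<Union>x\<in>S. N x)" if "S \<subseteq> A" for S
    using that fin finN by (meson finite_UN finite_subset subsetD)
  show ?case
  proof (cases "A = {}")
    case True
    then show ?thesis by auto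
  next
    case False
    show ?thesis
    proof (cases "\<exists>S. S \<subset> A \<and> S \<noteq> {} \<and> card S = card (\<Union>x\<in>S. N x)")
      case True
      then obtain S where S: "S \<subset> A" "S \<noteq> {}" "card S = card (\<Union>x\<in>S. N x)" by blast
      have finS: "finite S" using S fin finite_subset by blast
      have "\<exists>f. inj_on f S \<and> (\<forall>x\<in>S. f x \<in> N x)"
        using S finN H finS by (intro less.hyps psubset_card_mono fin) auto
      then obtain f where f: "inj_on f S" "\<forall>x\<in>S. f x \<in> N x" by blast
      define M where "M = (\<Union>x\<in>S. N x)"
      have "\<exists>h. inj_on h (A - S) \<and> (\<forall>x\<in>A - S. h x \<in> N x - M)"
      proof (rule less.hyps)
        show "card (A - S) < card A"
          using S fin by (intro psubset_card_mono) auto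
        fix T assume T: "T \<subseteq> A - S"
        have finT: "finite T" using T fin finite_subset by blast
        have "card S + card T = card (S \<union> T)"
          using T finS finT by (subst card_Un_disjoint) auto
        also have "\<dots> \<le> card (\<Union>x\<in>S \<union> T. N x)" using T S by (intro H) auto
        also have "(\<Union>x\<in>S \<union> T. N x) = M \<union> (\<Union>x\<in>T. N x - M)" by (auto simp: M_def)
        also have "card \<dots> \<le> card M + card (\<Union>x\<in>T. N x - M)" by (rule card_Un_le)
        finally show "card T \<le> card (\<Union>x\<in>T. N x - M)" using S(3) by (simp add: M_def)
      qed (use fin finN in auto)
      then obtain h where h: "inj_on h (A - S)" "\<forall>x\<in>A - S. h x \<in> N x - M" by blast
      have "inj_on (\<lambda>x. if x \<in> S then f x else h x) A"
        using f h unfolding inj_on_def M_def by (metis DiffE DiffI UN_I)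
      then show ?thesis
        using f h by (intro exI[of _ "\<lambda>x. if x \<in> S then f x else h x"]) auto
    next
      case noS: False
      obtain a where a: "a \<in> A" using False by blast
      have "card {a} \<le> card (\<Union>x\<in>{a}. N x)" using a by (intro H) auto
      then obtain b where b: "b \<in> N a" by fastforce
      have "\<exists>h. inj_on h (A - {a}) \<and> (\<forall>x\<in>A - {a}. h x \<in> N x - {b})"
      proof (rule less.hyps)
        show "card (A - {a}) < card A" using a fin by (intro psubset_card_mono) auto
        fix T assume T: "T \<subseteq> A - {a}"
        have finT: "finite T" using T fin finite_subset by blast
        show "card T \<le> card (\<Union>x\<in>T. N x - {b})"
        proof (cases "T = {}")
          case False
          have "T \<subset> A" using T a by blast
          then have "card T \<noteq> card (\<Union>x\<in>T. N x)" using noS False by blast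
          moreover have "card T \<le> card (\<Union>x\<in>T. N x)" using T by (intro H) auto
          ultimately have "card T < card (\<Union>x\<in>T. N x)" by simp
          moreover have "card (\<Union>x\<in>T. N x - {b}) \<ge> card (\<Union>x\<in>T. N x) - 1"
          proof -
            have "(\<Union>x\<in>T. N x - {b}) = (\<Union>x\<in>T. N x) - {b}" by auto
            then show ?thesis by (simp add: card_Diff_singleton_if)
          qed
          ultimately show ?thesis by linarith
        qed simp
      qed (use fin finN in auto)
      then obtain h where h: "inj_on h (A - {a})" "\<forall>x\<in>A - {a}. h x \<in> N x - {b}" by blast
      have "inj_on (h(a := b)) A"
        using h unfolding inj_on_def by (metis DiffE DiffI fun_upd_apply singletonD singletonI)
      then show ?thesis using h b by (intro exI[of _ "h(a := b)"]) auto
    qed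
  qed
qed

text \<open>
  The defect version follows by adding \<open>d\<close> dummy elements that every element of \<open>A\<close> may choose.
\<close>

corollary hall_defect:
  fixes N :: "'a \<Rightarrow> 'b set"
  assumes "finite A" "\<And>x. x \<in> A \<Longrightarrow> finite (N x)"
    and "\<And>S. S \<subseteq> A \<Longrightarrow> card S \<le> card (\<Union>x\<in>S. N x) + d"
  obtains D f where "D \<subseteq> A" "card A \<le> card D + d" "inj_on f D" "\<And>x. x \<in> D \<Longrightarrow> f x \<in> N x"
proof -
  define N' where "N' x = Inl ` N x \<union> Inr ` {..<d}" for x
  have "\<exists>f. inj_on f A \<and> (\<forall>x\<in>A. f x \<in> N' x)"
  proof (rule hall)
    fix S assume S: "S \<subseteq> A"
    show "card S \<le> card (\<Union>x\<in>S. N' x)"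
    proof (cases "S = {}")
      case False
      have fin: "finite (\<Union>x\<in>S. N x)" using S assms by (meson finite_UN finite_subset subsetD)
      have "(\<Union>x\<in>S. N' x) = Inl ` (\<Union>x\<in>S. N x) \<union> Inr ` {..<d}"
        using False by (auto simp: N'_def)
      also have "card \<dots> = card (\<Union>x\<in>S. N x) + d"
        by (subst card_Un_disjoint) (auto simp: fin card_image)
      finally show ?thesis using assms(3)[OF S] by simp
    qed simp
  qed (use assms in \<open>auto simp: N'_def\<close>)
  then obtain f where f: "inj_on f A" "\<And>x. x \<in> A \<Longrightarrow> f x \<in> N' x" by blast
  define D where "D = {x\<in>A. f x \<in> range Inl}"
  have DA: "D \<subseteq> A" by (auto simp: D_def)
  have finD: "finite D" using DA assms(1) finite_subset by blast
  have "f ` (A - D) \<subseteq> Inr ` {..<d}" using f(2) by (fastforce simp: D_def N'_def)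
  then have "card (f ` (A - D)) \<le> card (Inr ` {..<d} :: ('b + nat) set)" by (intro card_mono) auto
  then have "card (A - D) \<le> d"
    by (metis card_image card_lessThan f(1) inj_on_subset Diff_subset inj_Inr)
  then have "card A \<le> card D + d" using DA finD by (simp add: card_Diff_subset)
  moreover have "inj_on (projl \<circ> f) D"
    using f(1) DA unfolding inj_on_def D_def by auto
  moreover have "(projl \<circ> f) x \<in> N x" if "x \<in> D" for x
    using that f(2)[of x] by (auto simp: D_def N'_def)
  ultimately show ?thesis using that DA by blast
qed

section \<open>Matchings and points in general position\<close>

lemma finite_matching_cards:
  assumes "finite A"
  shows "finite {card D | D \<phi>. D \<subseteq> A \<and> inj_on \<phi> D \<and> \<phi> ` D \<subseteq> B \<and> (\<forall>x\<in>D. \<exists>U\<in>\<U>. {x, \<phi> x} \<subseteq> U)}"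
  by (rule finite_subset[of _ "{..card A}"]) (auto intro: card_mono assms)

lemma matching_number_attained:
  assumes "finite A"
  obtains D \<phi> where "D \<subseteq> A" "inj_on \<phi> D" "\<phi> ` D \<subseteq> B" "\<And>x. x \<in> D \<Longrightarrow> \<exists>U\<in>\<U>. {x, \<phi> x} \<subseteq> U"
    "card D = matching_number A B \<U>"
proof -
  let ?S = "{card D | D \<phi>. D \<subseteq> A \<and> inj_on \<phi> D \<and> \<phi> ` D \<subseteq> B \<and> (\<forall>x\<in>D. \<exists>U\<in>\<U>. {x, \<phi> x} \<subseteq> U)}"
  have "0 \<in> ?S" by (auto intro!: exI[of _ "{}"])
  then have "Max ?S \<in> ?S" by (intro Max_in finite_matching_cards assms) blast
  then obtain D \<phi> where "Max ?S = card D" "D \<subseteq> A" "inj_on \<phi> D" "\<phi> ` D \<subseteq> B"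
    "\<forall>x\<in>D. \<exists>U\<in>\<U>. {x, \<phi> x} \<subseteq> U"
    by blast
  then show ?thesis using that[of D \<phi>] unfolding matching_number_def by simp
qed

lemma matching_number_ge:
  assumes "finite A" "D \<subseteq> A" "inj_on \<phi> D" "\<phi> ` D \<subseteq> B" "\<And>x. x \<in> D \<Longrightarrow> \<exists>U\<in>\<U>. {x, \<phi> x} \<subseteq> U"
  shows "card D \<le> matching_number A B \<U>"
  unfolding matching_number_def
  using assms by (intro Max_ge finite_matching_cards) blast+

lemma matching_number_le:
  assumes "finite A"
  shows "matching_number A B \<U> \<le> card A"
proof -
  obtain D and \<phi> :: "'a \<Rightarrow> 'a" where "D \<subseteq> A" "card D = matching_number A B \<U>"
    using matching_number_attained[OF assms] by metis
  then show ?thesis using card_mono[OF assms] by metis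
qed

text \<open>
  Points are chosen one at a time; each previously chosen point excludes only finitely many candidates.
\<close>

lemma points_in_general_position:
  fixes N :: "'i \<Rightarrow> 'a::group_add set"
  assumes "finite I" "finite E" "\<And>i. i \<in> I \<Longrightarrow> infinite (N i)"
  shows "\<exists>q. inj_on q I \<and> (\<forall>i\<in>I. q i \<in> N i) \<and> (\<forall>i\<in>I. \<forall>j\<in>I. \<forall>g\<in>E. g \<noteq> 0 \<longrightarrow> q i \<noteq> g + q j)"
  using assms(1,3)
proof (induction I)
  case (insert a I)
  then obtain q where q: "inj_on q I" "\<forall>i\<in>I. q i \<in> N i"
    "\<forall>i\<in>I. \<forall>j\<in>I. \<forall>g\<in>E. g \<noteq> 0 \<longrightarrow> q i \<noteq> g + q j"
    by auto
  define X where "X = q ` I \<union> (\<Union>g\<in>E. (\<lambda>j. g + q j) ` I) \<union> (\<Union>g\<in>E. (\<lambda>j. - g + q j) ` I)"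
  have "finite X" using insert assms(2) by (auto simp: X_def)
  then have "infinite (N a - X)" using insert.prems by (intro Diff_infinite_finite) auto
  then obtain p where p: "p \<in> N a" "p \<notin> X" by (metis DiffE finite.emptyI ex_in_conv)
  have p1: "p \<noteq> q i" if "i \<in> I" for i using p(2) that by (auto simp: X_def)
  have p2: "p \<noteq> g + q i" if "i \<in> I" "g \<in> E" for i g using p(2) that by (auto simp: X_def)
  have p3: "q i \<noteq> g + p" if "i \<in> I" "g \<in> E" for i g
  proof
    assume "q i = g + p"
    then have "p = - g + q i" by simp
    then show False using p(2) that by (auto simp: X_def)
  qed
  have p4: "p \<noteq> g + p" if "g \<noteq> 0" for g
    using that by (metis add_0 add_right_cancel)
  let ?q = "q(a := p)"
  have "inj_on ?q (insert a I)"
    using q(1) p1 insert.hyps(2) by (auto simp: inj_on_def)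
  moreover have "\<forall>i\<in>insert a I. ?q i \<in> N i"
    using q(2) p(1) by auto
  moreover have "\<forall>i\<in>insert a I. \<forall>j\<in>insert a I. \<forall>g\<in>E. g \<noteq> 0 \<longrightarrow> ?q i \<noteq> g + ?q j"
    using q(3) p2 p3 p4 insert.hyps(2) by simp
  ultimately show ?case by blast
qed auto

section \<open>From efficient coverings to matchings\<close>

text \<open>
  Exchange argument: a minimal refinement \<open>\<A>\<close> of \<open>\<V>\<close> injects into every refinement \<open>\<C>\<close> such that
  corresponding members meet. If a subfamily \<open>\<S>\<close> of \<open>\<A>\<close> met fewer than \<open>card \<S>\<close> members of \<open>\<C>\<close>,
  replacing \<open>\<S>\<close> by these members would produce a smaller uniform covering; so Hall's condition holds.
\<close>

lemma minimal_refinement_injects: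
  assumes \<A>: "\<A> \<in> fin_uniform_covers" "\<V> \<preceq> \<A>" "card \<A> = cover_number \<V>"
    and \<C>: "\<C> \<in> fin_uniform_covers" "\<V> \<preceq> \<C>"
  obtains a where "inj_on a \<A>" "\<And>A. A \<in> \<A> \<Longrightarrow> a A \<in> \<C>" "\<And>A. A \<in> \<A> \<Longrightarrow> A \<inter> a A \<noteq> {}"
proof -
  obtain O1 where O1: "finite \<A>" "open O1" "0 \<in> O1" "\<And>x. \<exists>U\<in>\<A>. \<forall>v\<in>O1. v + x \<in> U"
    using fin_uniform_coversE[OF \<A>(1)] by blast
  obtain O2 where O2: "finite \<C>" "open O2" "0 \<in> O2" "\<And>x. \<exists>U\<in>\<C>. \<forall>v\<in>O2. v + x \<in> U"
    using fin_uniform_coversE[OF \<C>(1)] by blast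
  define N where "N A = {C\<in>\<C>. A \<inter> C \<noteq> {}}" for A
  have "\<exists>a. inj_on a \<A> \<and> (\<forall>A\<in>\<A>. a A \<in> N A)"
  proof (rule hall)
    fix \<S> assume \<S>: "\<S> \<subseteq> \<A>"
    define \<T> where "\<T> = (\<Union>A\<in>\<S>. N A)"
    have "\<T> \<subseteq> \<C>" by (auto simp: \<T>_def N_def)
    then have fin: "finite \<S>" "finite \<T>"
      using \<S> O1(1) O2(1) finite_subset by blast+
    \<comment> \<open>At each point some member of \<open>\<A>\<close> and some member of \<open>\<C>\<close> are locally large; if the former
      belongs to \<open>\<S>\<close>, then the two meet and the latter belongs to \<open>\<T>\<close>.\<close>
    have "(\<A> - \<S>) \<union> \<T> \<in> fin_uniform_covers"
    proof (rule fin_uniform_coversI[of _ "O1 \<inter> O2"])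
      fix x
      obtain A where A: "A \<in> \<A>" "\<forall>v\<in>O1. v + x \<in> A" using O1(4) by blast
      obtain C where C: "C \<in> \<C>" "\<forall>v\<in>O2. v + x \<in> C" using O2(4) by blast
      have "x \<in> A \<inter> C" using A(2) C(2) O1(3) O2(3) by force
      then have "A \<in> \<S> \<Longrightarrow> C \<in> \<T>" using C(1) by (auto simp: \<T>_def N_def)
      then show "\<exists>U\<in>(\<A> - \<S>) \<union> \<T>. \<forall>v\<in>O1 \<inter> O2. v + x \<in> U"
        using A C by (metis DiffI IntE UnI1 UnI2)
    qed (use O1(1-3) O2(1-3) fin in auto)
    moreover have "\<V> \<preceq> (\<A> - \<S>) \<union> \<T>"
      using \<A>(2) \<C>(2) unfolding refined_by_def \<T>_def N_def by blast
    ultimately have "card \<A> \<le> card ((\<A> - \<S>) \<union> \<T>)"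
      using cover_number_le \<A>(3) by metis
    also have "\<dots> \<le> card (\<A> - \<S>) + card \<T>" by (rule card_Un_le)
    also have "card (\<A> - \<S>) = card \<A> - card \<S>" using \<S> fin(1) by (simp add: card_Diff_subset)
    finally show "card \<S> \<le> card (\<Union>A\<in>\<S>. N A)"
      using card_mono[OF O1(1) \<S>] by (simp add: \<T>_def)
  qed (use O1(1) O2(1) in \<open>auto simp: N_def\<close>)
  then show ?thesis using that by (auto simp: N_def)
qed

text \<open>
  A finite member contains no uniform neighborhood of any point, so a minimal refinement could dispense
  with it.
\<close>

lemma minimal_refinement_infinite:
  fixes \<A> :: "'a::{topological_group_add, t2_space} set set"
  assumes nd: "\<not> (\<forall>A :: 'a set. open A)"
    and \<A>: "\<A> \<in> fin_uniform_covers" "\<V> \<preceq> \<A>" "card \<A> = cover_number \<V>" and A: "A \<in> \<A>"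
  shows "infinite A"
proof
  assume fin: "finite A"
  obtain V where V: "finite \<A>" "open V" "0 \<in> V" "\<And>x. \<exists>U\<in>\<A>. \<forall>v\<in>V. v + x \<in> U"
    using fin_uniform_coversE[OF \<A>(1)] by blast
  have inf: "infinite V" using nondiscrete_open_infinite[OF nd V(2,3)] .
  have "\<A> - {A} \<in> fin_uniform_covers"
  proof (rule fin_uniform_coversI[OF _ V(2,3)])
    fix x
    obtain U where U: "U \<in> \<A>" "\<forall>v\<in>V. v + x \<in> U" using V(4) by blast
    have "(\<lambda>v. v + x) ` V \<subseteq> U" using U by auto
    moreover have "infinite ((\<lambda>v. v + x) ` V)"
      using inf by (simp add: finite_image_iff inj_on_def)
    ultimately have "U \<noteq> A" using fin finite_subset by blast
    then show "\<exists>U\<in>\<A> - {A}. \<forall>v\<in>V. v + x \<in> U" using U by blast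
  qed (use V(1) in auto)
  moreover have "\<V> \<preceq> \<A> - {A}" using \<A>(2) by (auto simp: refined_by_def)
  ultimately have "card \<A> \<le> card (\<A> - {A})" using cover_number_le \<A>(3) by metis
  moreover have "card (\<A> - {A}) < card \<A>" using V(1) A by (rule card_Diff1_less)
  ultimately show False by simp
qed

text \<open>
  Let \<open>\<A>\<close> be a minimal refinement of \<open>\<V>\<close> and \<open>\<C>\<close> one of \<open>\<V> \<or> g(\<V>)\<close>. Both \<open>\<A>\<close> and \<open>g(\<A>)\<close> inject into
  \<open>\<C>\<close>, so at least \<open>2 card \<A> - card \<C>\<close> members of \<open>\<C>\<close> are hit twice. Each of these members links a member
  \<open>A\<close> of \<open>\<A>\<close> to a translate \<open>g B\<close> with \<open>B\<close> in \<open>\<A>\<close>; hence \<open>F\<close> may consist of one point from each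
  member of \<open>\<A>\<close>, provided that \<open>\<V>\<close> is fine enough for the links to stay within members of \<open>\<U>\<close>.
\<close>

lemma matching_from_cover:
  fixes \<U> :: "'a::{topological_group_add, t2_space} set set"
  assumes nd: "\<not> (\<forall>A :: 'a set. open A)" and E: "finite E" and \<U>: "\<U> \<in> fin_uniform_covers"
  obtains \<U>' where "\<U>' \<in> fin_uniform_covers"
    "\<And>\<V>. \<V> \<in> fin_uniform_covers \<Longrightarrow> \<U>' \<preceq> \<V> \<Longrightarrow>
      \<exists>F. finite F \<and> card F = cover_number \<V> \<and>
        (\<forall>g\<in>E. 2 * card F \<le>
          matching_number F (ltranslate g F) \<U> + cover_number (join_cover \<V> (ltranslate g ` \<V>)))"
proof -
  obtain \<U>1 where \<U>1: "\<U>1 \<in> fin_uniform_covers" "\<U> \<preceq> \<U>1"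
    "\<And>W. W \<in> \<U>1 \<Longrightarrow> \<exists>U\<in>\<U>. \<forall>W'\<in>\<U>1. W \<inter> W' \<noteq> {} \<longrightarrow> W \<union> W' \<subseteq> U"
    using star_refinement[OF \<U>] by blast
  \<comment> \<open>With the translates by \<open>- g\<close> refined as well, not only the members of a refinement of \<open>\<U>2\<close> but
    also their translates by \<open>g\<close> are small with respect to \<open>\<U>1\<close>.\<close>
  obtain \<U>2 where \<U>2: "\<U>2 \<in> fin_uniform_covers" "\<U>1 \<preceq> \<U>2"
    "\<And>g. g \<in> uminus ` E \<Longrightarrow> ltranslate g ` \<U>1 \<preceq> \<U>2"
    using translates_common_refinement[OF \<U>1(1), of "uminus ` E"] E by blast
  show ?thesis
  proof (rule that[OF \<U>2(1)])
    fix \<V> assume \<V>: "\<V> \<in> fin_uniform_covers" "\<U>2 \<preceq> \<V>"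
    obtain \<A> where \<A>: "\<A> \<in> fin_uniform_covers" "\<V> \<preceq> \<A>" "card \<A> = cover_number \<V>"
      using cover_number_attained[OF \<V>(1)] by blast
    have fin\<A>: "finite \<A>" using \<A>(1) by (simp add: fin_uniform_covers_def)
    obtain p where p: "inj_on p \<A>" "\<forall>A\<in>\<A>. p A \<in> A"
      using points_in_general_position[of \<A> "{}" "\<lambda>A. A"] fin\<A> minimal_refinement_infinite[OF nd \<A>]
      by auto
    have in1: "\<exists>W\<in>\<U>1. A \<subseteq> W" if "A \<in> \<A>" for A
      using refined_by_trans[OF refined_by_trans[OF \<U>2(2) \<V>(2)] \<A>(2)] that by (auto simp: refined_by_def)
    have "2 * card (p ` \<A>) \<le> matching_number (p ` \<A>) (ltranslate g (p ` \<A>)) \<U>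
        + cover_number (join_cover \<V> (ltranslate g ` \<V>))" if g: "g \<in> E" for g
    proof -
      obtain \<C> where \<C>: "\<C> \<in> fin_uniform_covers" "join_cover \<V> (ltranslate g ` \<V>) \<preceq> \<C>"
        "card \<C> = cover_number (join_cover \<V> (ltranslate g ` \<V>))"
        using cover_number_attained[OF join_cover_fin_uniform[OF \<V>(1) ltranslate_fin_uniform[OF \<V>(1)]]]
        by blast
      have fin\<C>: "finite \<C>" using \<C>(1) by (simp add: fin_uniform_covers_def)
      have \<V>\<C>: "\<V> \<preceq> \<C>" and g\<V>\<C>: "ltranslate g ` \<V> \<preceq> \<C>"
        using \<C>(2) join_cover_refines refined_by_trans by blast+
      obtain a where a: "inj_on a \<A>" "\<And>A. A \<in> \<A> \<Longrightarrow> a A \<in> \<C>" "\<And>A. A \<in> \<A> \<Longrightarrow> A \<inter> a A \<noteq> {}"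
        using minimal_refinement_injects[OF \<A> \<C>(1) \<V>\<C>] by blast
      have "ltranslate (- g) ` ltranslate g ` \<V> \<preceq> ltranslate (- g) ` \<C>"
        by (rule ltranslate_refined_by[OF g\<V>\<C>])
      then have "\<V> \<preceq> ltranslate (- g) ` \<C>" by (simp add: image_image ltranslate_inverse)
      then obtain b' where b': "inj_on b' \<A>" "\<And>A. A \<in> \<A> \<Longrightarrow> b' A \<in> ltranslate (- g) ` \<C>"
        "\<And>A. A \<in> \<A> \<Longrightarrow> A \<inter> b' A \<noteq> {}"
        using minimal_refinement_injects[OF \<A> ltranslate_fin_uniform[OF \<C>(1)]] by blast
      define b where "b A = ltranslate g (b' A)" for A
      have b1: "inj_on b \<A>"
        using b'(1) inj_ltranslate[of g] by (auto simp: b_def inj_on_def)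
      have b2: "b A \<in> \<C>" if "A \<in> \<A>" for A
        using b'(2)[OF that] by (auto simp: b_def ltranslate_inverse)
      have b3: "\<exists>y\<in>A. g + y \<in> b A" if "A \<in> \<A>" for A
        using b'(3)[OF that] by (auto simp: b_def)
      define \<D> where "\<D> = {A\<in>\<A>. a A \<in> b ` \<A>}"
      have card\<D>: "2 * card \<A> \<le> card \<D> + card \<C>"
      proof -
        have "card \<A> + card \<A> = card (a ` \<A>) + card (b ` \<A>)"
          using a(1) b1 by (simp add: card_image)
        also have "\<dots> = card (a ` \<A> \<union> b ` \<A>) + card (a ` \<A> \<inter> b ` \<A>)"
          using fin\<A> by (intro card_Un_Int) auto
        also have "card (a ` \<A> \<union> b ` \<A>) \<le> card \<C>"
          using fin\<C> a(2) b2 by (intro card_mono) auto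
        also have "a ` \<A> \<inter> b ` \<A> = a ` \<D>" by (auto simp: \<D>_def)
        also have "card (a ` \<D>) = card \<D>"
          using a(1) by (intro card_image) (auto simp: \<D>_def inj_on_def)
        finally show ?thesis by simp
      qed
      define \<beta> where "\<beta> A = (SOME B. B \<in> \<A> \<and> b B = a A)" for A
      have \<beta>: "\<beta> A \<in> \<A> \<and> b (\<beta> A) = a A" if "A \<in> \<D>" for A
        unfolding \<beta>_def by (rule someI_ex) (use that in \<open>auto simp: \<D>_def\<close>)
      define q where "q = inv_into \<A> p"
      have q: "q (p A) = A" if "A \<in> \<A>" for A
        using p(1) that by (simp add: q_def)
      define \<phi> where "\<phi> x = g + p (\<beta> (q x))" for x
      have \<D>: "\<D> \<subseteq> \<A>" by (auto simp: \<D>_def)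
      have \<phi>: "\<phi> (p A) = g + p (\<beta> A)" if "A \<in> \<D>" for A
        using that \<D> q by (auto simp: \<phi>_def)
      have "card (p ` \<D>) \<le> matching_number (p ` \<A>) (ltranslate g (p ` \<A>)) \<U>"
      proof (rule matching_number_ge)
        show "inj_on \<phi> (p ` \<D>)"
        proof (rule inj_onI, clarsimp)
          fix A B assume AB: "A \<in> \<D>" "B \<in> \<D>" "\<phi> (p A) = \<phi> (p B)"
          then have "\<beta> A = \<beta> B" using \<phi> \<beta> p(1) by (simp add: inj_on_eq_iff)
          then have "a A = a B" using \<beta> AB by metis
          then show "p A = p B" using a(1) AB \<D> by (metis inj_onD subsetD)
        qed
        show "\<phi> ` p ` \<D> \<subseteq> ltranslate g (p ` \<A>)"
          using \<phi> \<beta> by (auto simp: image_subset_iff)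
        fix x assume "x \<in> p ` \<D>"
        then obtain A where A: "A \<in> \<D>" "x = p A" by blast
        then have A': "A \<in> \<A>" "\<beta> A \<in> \<A>" "b (\<beta> A) = a A" using \<beta> \<D> by auto
        \<comment> \<open>The chain \<open>A\<close>, \<open>a A = b (\<beta> A)\<close>, \<open>g + \<beta> A\<close> of sets meeting one another lies in the star of
          the member of \<open>\<U>1\<close> around its middle part.\<close>
        obtain u1 where u1: "u1 \<in> \<U>1" "A \<subseteq> u1" using in1 A' by blast
        obtain u2 where u2: "u2 \<in> \<U>1" "a A \<subseteq> u2"
          using refined_by_trans[OF refined_by_trans[OF \<U>2(2) \<V>(2)] \<V>\<C>] a(2)[OF A'(1)]
          unfolding refined_by_def by blast
        obtain u3 where u3: "u3 \<in> \<U>1" "\<beta> A \<subseteq> ltranslate (- g) u3"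
        proof -
          have "ltranslate (- g) ` \<U>1 \<preceq> \<A>"
            using refined_by_trans[OF refined_by_trans[OF \<U>2(3) \<V>(2)] \<A>(2)] g by blast
          then show ?thesis using that A'(2) unfolding refined_by_def by blast
        qed
        obtain U where U: "U \<in> \<U>" "\<forall>W'\<in>\<U>1. u2 \<inter> W' \<noteq> {} \<longrightarrow> u2 \<union> W' \<subseteq> U"
          using \<U>1(3)[OF u2(1)] by blast
        have "u2 \<inter> u1 \<noteq> {}" using a(3)[OF A'(1)] u1 u2 by blast
        then have "x \<in> U" using U(2) u1 p(2) A A' by blast
        moreover obtain y where y: "y \<in> \<beta> A" "g + y \<in> a A" using b3[OF A'(2)] A'(3) by auto
        have "u2 \<inter> u3 \<noteq> {}" using y u2 u3 by fastforce
        then have "u3 \<subseteq> U" using U(2) u3 by blast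
        then have "\<phi> x \<in> U" using \<phi>[OF A(1)] A(2) p(2) A'(2) u3(2) by fastforce
        ultimately show "\<exists>U\<in>\<U>. {x, \<phi> x} \<subseteq> U" using U(1) by blast
      qed (use fin\<A> \<D> in auto)
      moreover have "card (p ` \<D>) = card \<D>" "card (p ` \<A>) = card \<A>"
        using p(1) \<D> by (auto intro!: card_image intro: inj_on_subset)
      ultimately show ?thesis using card\<D> \<C>(3) by linarith
    qed
    then show "\<exists>F. finite F \<and> card F = cover_number \<V> \<and> (\<forall>g\<in>E. 2 * card F \<le>
        matching_number F (ltranslate g F) \<U> + cover_number (join_cover \<V> (ltranslate g ` \<V>)))"
      using \<A>(3) p(1) fin\<A> by (intro exI[of _ "p ` \<A>"]) (auto simp: card_image)
  qed
qed

section \<open>From matchings to efficient coverings\<close>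

text \<open>
  A family need only be fine off a finite set, as long as it contains a neighborhood of each of the
  finitely many exceptional points.
\<close>

lemma fin_uniform_cover_finite_exception:
  assumes \<U>: "\<U> \<in> fin_uniform_covers" and R: "finite R" and \<C>: "finite \<C>"
    and off: "\<And>U. U \<in> \<U> \<Longrightarrow> \<exists>C\<in>\<C>. U - R \<subseteq> C"
    and at: "\<And>r. r \<in> R \<Longrightarrow> \<exists>C\<in>\<C>. open C \<and> r \<in> C"
  shows "\<C> \<in> fin_uniform_covers"
proof -
  obtain V where V: "finite \<U>" "open V" "0 \<in> V" "\<And>x. \<exists>U\<in>\<U>. \<forall>v\<in>V. v + x \<in> U"
    using fin_uniform_coversE[OF \<U>(1)] by blast
  have "\<exists>P. open P \<and> 0 \<in> P \<and> (\<forall>p\<in>P. - p \<in> P) \<and> (\<exists>C\<in>\<C>. \<forall>a\<in>P. \<forall>b\<in>P. a + b + r \<in> C)"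
    if r: "r \<in> R" for r
  proof -
    obtain C where C: "C \<in> \<C>" "open C" "r \<in> C" using at[OF r] by blast
    obtain P where "open P" "0 \<in> P" "\<And>p. p \<in> P \<Longrightarrow> - p \<in> P"
      "\<And>a b. a \<in> P \<Longrightarrow> b \<in> P \<Longrightarrow> a + b + r \<in> C"
      using nbhd_sum2[OF C(2,3)] by blast
    then show ?thesis using C(1) by blast
  qed
  then obtain P where P: "\<And>r. r \<in> R \<Longrightarrow> open (P r) \<and> 0 \<in> P r \<and> (\<forall>p\<in>P r. - p \<in> P r) \<and>
      (\<exists>C\<in>\<C>. \<forall>a\<in>P r. \<forall>b\<in>P r. a + b + r \<in> C)"
    by metis
  \<comment> \<open>If \<open>W + x\<close> contains an exceptional point \<open>r\<close>, then \<open>W + x \<subseteq> P r + P r + r\<close> lies in the member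
    around \<open>r\<close>; otherwise removing \<open>R\<close> does not affect \<open>W + x\<close>.\<close>
  define W where "W = V \<inter> (\<Inter>r\<in>R. P r)"
  show ?thesis
  proof (rule fin_uniform_coversI[OF \<C>])
    show "open W" unfolding W_def using V R P by (intro open_Int open_INT) auto
    show "0 \<in> W" using V P by (auto simp: W_def)
    fix x
    show "\<exists>C\<in>\<C>. \<forall>v\<in>W. v + x \<in> C"
    proof (cases "\<exists>w\<in>W. w + x \<in> R")
      case True
      then obtain w where w: "w \<in> W" "w + x \<in> R" by blast
      obtain C where C: "C \<in> \<C>" "\<forall>a\<in>P (w + x). \<forall>b\<in>P (w + x). a + b + (w + x) \<in> C"
        using P[OF w(2)] by blast
      have mw: "- w \<in> P (w + x)" using P[OF w(2)] w by (auto simp: W_def)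
      have "v + x \<in> C" if "v \<in> W" for v
      proof -
        have "v \<in> P (w + x)" using that w(2) by (auto simp: W_def)
        then have "v + - w + (w + x) \<in> C" using C(2) mw by blast
        then show ?thesis by (simp add: add.assoc del: add_uminus_conv_diff)
      qed
      then show ?thesis using C(1) by blast
    next
      case False
      obtain U where U: "U \<in> \<U>" "\<forall>v\<in>V. v + x \<in> U" using V by blast
      obtain C where "C \<in> \<C>" "U - R \<subseteq> C" using off[OF U(1)] by blast
      then show ?thesis using U(2) False by (intro bexI[of _ C]) (auto simp: W_def)
    qed
  qed
qed

text \<open>
  Each point \<open>q x\<close> is pinned down: the only member of \<open>pinned_cover\<close> that contains it is the one
  indexed by \<open>x\<close>. This forces the covering number up to \<open>card I\<close>.
\<close>

definition pinned_member :: "'i set \<Rightarrow> ('i \<Rightarrow> 'a) \<Rightarrow> ('i \<Rightarrow> 'a set) \<Rightarrow> 'i \<Rightarrow> 'a set"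
  where "pinned_member I q i x = i x - (q ` I - {q x})"

definition pinned_cover :: "'i set \<Rightarrow> ('i \<Rightarrow> 'a) \<Rightarrow> ('i \<Rightarrow> 'a set) \<Rightarrow> 'a set set \<Rightarrow> 'a set set"
  where "pinned_cover I q i \<U> = pinned_member I q i ` I \<union> (\<lambda>U. U - q ` I) ` \<U>"

context
  fixes I :: "'i set" and q :: "'i \<Rightarrow> 'a::{topological_group_add, t2_space}" and i \<U>
  assumes \<U>: "\<U> \<in> fin_uniform_covers" "\<And>U. U \<in> \<U> \<Longrightarrow> open U"
    and I: "finite I" and q: "inj_on q I" and i: "\<And>x. x \<in> I \<Longrightarrow> i x \<in> \<U>" "\<And>x. x \<in> I \<Longrightarrow> q x \<in> i x"
begin

lemma open_pinned_member: "x \<in> I \<Longrightarrow> open (pinned_member I q i x)"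
  unfolding pinned_member_def using I i(1) \<U>(2) by (intro open_Diff finite_imp_closed) auto

lemma open_unpinned: "U \<in> \<U> \<Longrightarrow> open (U - q ` I)"
  using I \<U>(2) by (intro open_Diff finite_imp_closed) auto

lemma finite_cover: "finite \<U>"
  using \<U>(1) by (simp add: fin_uniform_covers_def)

lemma pinned_cover_fin_uniform: "pinned_cover I q i \<U> \<in> fin_uniform_covers"
proof (rule fin_uniform_cover_finite_exception[OF \<U>(1), of "q ` I"])
  show "finite (pinned_cover I q i \<U>)" using I finite_cover by (simp add: pinned_cover_def)
  show "\<exists>C\<in>pinned_cover I q i \<U>. U - q ` I \<subseteq> C" if "U \<in> \<U>" for U
    using that by (auto simp: pinned_cover_def)
  show "\<exists>C\<in>pinned_cover I q i \<U>. open C \<and> r \<in> C" if r: "r \<in> q ` I" for r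
  proof -
    obtain x where x: "x \<in> I" "r = q x" using r by blast
    then have "r \<in> pinned_member I q i x" using i by (auto simp: pinned_member_def)
    then show ?thesis using x open_pinned_member by (auto simp: pinned_cover_def)
  qed
qed (use I in auto)

lemma pinned_cover_refines: "\<U> \<preceq> pinned_cover I q i \<U>"
  using i(1) by (auto simp: refined_by_def pinned_cover_def pinned_member_def)

lemma cover_number_pinned_ge: "card I \<le> cover_number (pinned_cover I q i \<U>)"
proof -
  obtain \<W> where \<W>: "\<W> \<in> fin_uniform_covers" "pinned_cover I q i \<U> \<preceq> \<W>"
    "card \<W> = cover_number (pinned_cover I q i \<U>)"
    using cover_number_attained[OF pinned_cover_fin_uniform] by blast
  have "\<forall>x. \<exists>W. W \<in> \<W> \<and> q x \<in> W" using fin_uniform_covers_covers[OF \<W>(1)] by blast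
  then obtain f where f: "\<And>x. f x \<in> \<W> \<and> q x \<in> f x" by metis
  have "inj_on f I"
  proof (rule inj_onI)
    fix x y assume xy: "x \<in> I" "y \<in> I" "f x = f y"
    obtain P where P: "P \<in> pinned_cover I q i \<U>" "f x \<subseteq> P"
      using \<W>(2) f[of x] by (auto simp: refined_by_def)
    have "q x \<in> P" "q y \<in> P" using f xy P by (metis subsetD)+
    then have "q x = q y"
      using P(1) xy by (auto simp: pinned_cover_def pinned_member_def)
    then show "x = y" using q xy by (simp add: inj_on_eq_iff)
  qed
  moreover have "finite \<W>" using \<W>(1) by (simp add: fin_uniform_covers_def)
  ultimately have "card I \<le> card \<W>" using f by (intro card_inj_on_le[of f]) auto
  then show ?thesis using \<W>(3) by simp
qed

text \<open>
  To cover \<open>\<V> \<or> g(\<V>)\<close> for the pinned covering \<open>\<V>\<close>, spend one member on each matched pair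
  \<open>q x\<close>, \<open>g + q (\<psi> x)\<close>, one on each unmatched \<open>q x\<close> and each unmatched \<open>g + q y\<close>, and boundedly many on
  the remaining part of the group.
\<close>

lemma cover_number_pinned_join_le:
  assumes disj: "\<And>x y. x \<in> I \<Longrightarrow> y \<in> I \<Longrightarrow> q x \<noteq> g + q y"
    and D: "D \<subseteq> I" "inj_on \<psi> D" "\<psi> ` D \<subseteq> I"
    and \<psi>: "\<And>x. x \<in> D \<Longrightarrow> g + q (\<psi> x) \<in> i x" "\<And>x. x \<in> D \<Longrightarrow> - g + q x \<in> i (\<psi> x)"
  shows "cover_number (join_cover (pinned_cover I q i \<U>) (ltranslate g ` pinned_cover I q i \<U>)) + card D
    \<le> 2 * card I + card \<U> * card \<U>"
proof -
  define P where "P = pinned_member I q i"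
  define W where "W U = U - q ` I" for U
  define u where "u z = (SOME U. U \<in> \<U> \<and> z \<in> U)" for z
  have u: "u z \<in> \<U> \<and> z \<in> u z" for z
    unfolding u_def by (rule someI_ex) (use fin_uniform_covers_covers[OF \<U>(1)] in blast)
  define \<C>1 where "\<C>1 = (\<lambda>x. P x \<inter> ltranslate g (P (\<psi> x))) ` D"
  define \<C>2 where "\<C>2 = (\<lambda>x. P x \<inter> ltranslate g (W (u (- g + q x)))) ` (I - D)"
  define \<C>3 where "\<C>3 = (\<lambda>y. W (u (g + q y)) \<inter> ltranslate g (P y)) ` (I - \<psi> ` D)"
  define \<C>4 where "\<C>4 = (\<lambda>(U, U'). W U \<inter> ltranslate g (W U')) ` (\<U> \<times> \<U>)"
  define \<C> where "\<C> = \<C>1 \<union> \<C>2 \<union> \<C>3 \<union> \<C>4"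
  have disj': "- g + q x \<notin> q ` I" if "x \<in> I" for x
  proof
    assume "- g + q x \<in> q ` I"
    then obtain y where "y \<in> I" "- g + q x = q y" by auto
    then have "q x = g + q y" by (metis add_minus_cancel)
    then show False using disj that \<open>y \<in> I\<close> by blast
  qed
  have disj'': "g + q y \<notin> q ` I" if "y \<in> I" for y
    using disj that by (metis imageE)
  have finD: "finite D" using D(1) I finite_subset by blast
  have Pq: "q x \<in> P x" if "x \<in> I" for x
    using i(2)[OF that] by (simp add: P_def pinned_member_def)
  have opP: "open (P x)" if "x \<in> I" for x using open_pinned_member that by (simp add: P_def)
  have opW: "open (W U)" if "U \<in> \<U>" for U using open_unpinned that by (simp add: W_def)
  have join: "\<exists>C\<in>\<C>. U - (q ` I \<union> ltranslate g (q ` I)) \<subseteq> C"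
    if U: "U \<in> join_cover \<U> (ltranslate g ` \<U>)" for U
  proof -
    obtain A B where AB: "A \<in> \<U>" "B \<in> \<U>" "U = A \<inter> ltranslate g B"
      using U by (auto simp: join_cover_def)
    then have "W A \<inter> ltranslate g (W B) \<in> \<C>" by (auto simp: \<C>_def \<C>4_def)
    moreover have "U - (q ` I \<union> ltranslate g (q ` I)) \<subseteq> W A \<inter> ltranslate g (W B)"
      using AB by (auto simp: W_def)
    ultimately show ?thesis by blast
  qed
  have at: "\<exists>C\<in>\<C>. open C \<and> r \<in> C" if mem: "r \<in> q ` I \<union> ltranslate g (q ` I)" for r
  proof -
    consider (d) x where "x \<in> D" "r = q x \<or> r = g + q (\<psi> x)"
      | (l) x where "x \<in> I - D" "r = q x" | (r) y where "y \<in> I - \<psi> ` D" "r = g + q y"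
      using mem unfolding ltranslate_def by blast
    then show ?thesis
    proof cases
      case d
      have x: "x \<in> I" "\<psi> x \<in> I" using d D by auto
      have "r \<in> P x \<inter> ltranslate g (P (\<psi> x))"
      proof (cases "r = q x")
        case True
        then show ?thesis using Pq[OF x(1)] \<psi>(2)[OF d(1)] disj'[OF x(1)]
          by (auto simp: P_def pinned_member_def)
      next
        case False
        then have "r = g + q (\<psi> x)" using d by auto
        then show ?thesis using Pq[OF x(2)] \<psi>(1)[OF d(1)] disj''[OF x(2)]
          by (auto simp: P_def pinned_member_def)
      qed
      moreover have "open (P x \<inter> ltranslate g (P (\<psi> x)))"
        using x by (intro open_Int open_ltranslate opP)
      ultimately show ?thesis using d(1) by (auto simp: \<C>_def \<C>1_def)
    next
      case l
      have "r \<in> P x \<inter> ltranslate g (W (u (- g + q x)))"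
        using l Pq u[of "- g + q x"] disj'[of x] by (auto simp: W_def)
      moreover have "open (P x \<inter> ltranslate g (W (u (- g + q x))))"
        using l u by (intro open_Int open_ltranslate opP opW) auto
      ultimately show ?thesis using l(1) by (auto simp: \<C>_def \<C>2_def)
    next
      case r
      have "r \<in> W (u (g + q y)) \<inter> ltranslate g (P y)"
        using r Pq u[of "g + q y"] disj''[of y] by (auto simp: W_def)
      moreover have "open (W (u (g + q y)) \<inter> ltranslate g (P y))"
        using r u by (intro open_Int open_ltranslate opP opW) auto
      ultimately show ?thesis using r(1) by (auto simp: \<C>_def \<C>3_def)
    qed
  qed
  have fin: "finite \<C>1" "finite \<C>2" "finite \<C>3" "finite \<C>4"
    using finD I finite_cover by (auto simp: \<C>1_def \<C>2_def \<C>3_def \<C>4_def)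
  have fuc: "\<C> \<in> fin_uniform_covers"
    by (rule fin_uniform_cover_finite_exception[OF join_cover_fin_uniform[OF \<U>(1) ltranslate_fin_uniform[OF \<U>(1)]] _ _ join at])
       (use I fin in \<open>auto simp: \<C>_def finite_ltranslate\<close>)
  have PP: "P x \<in> pinned_cover I q i \<U>" if "x \<in> I" for x
    using that by (auto simp: pinned_cover_def P_def)
  have WP: "W U \<in> pinned_cover I q i \<U>" if "U \<in> \<U>" for U
    using that by (auto simp: pinned_cover_def W_def)
  have J: "A \<inter> ltranslate g B \<in> join_cover (pinned_cover I q i \<U>) (ltranslate g ` pinned_cover I q i \<U>)"
    if "A \<in> pinned_cover I q i \<U>" "B \<in> pinned_cover I q i \<U>" for A B
    using that by (auto simp: join_cover_def)
  have "\<C> \<subseteq> join_cover (pinned_cover I q i \<U>) (ltranslate g ` pinned_cover I q i \<U>)"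
    unfolding \<C>_def
  proof (intro Un_least)
    show "\<C>1 \<subseteq> join_cover (pinned_cover I q i \<U>) (ltranslate g ` pinned_cover I q i \<U>)"
      unfolding \<C>1_def using D by (intro image_subsetI J PP) auto
    show "\<C>2 \<subseteq> join_cover (pinned_cover I q i \<U>) (ltranslate g ` pinned_cover I q i \<U>)"
      unfolding \<C>2_def using u by (intro image_subsetI J PP WP) auto
    show "\<C>3 \<subseteq> join_cover (pinned_cover I q i \<U>) (ltranslate g ` pinned_cover I q i \<U>)"
      unfolding \<C>3_def using u by (intro image_subsetI J PP WP) auto
    show "\<C>4 \<subseteq> join_cover (pinned_cover I q i \<U>) (ltranslate g ` pinned_cover I q i \<U>)"
      unfolding \<C>4_def by (auto intro!: J WP)
  qed
  then have "cover_number (join_cover (pinned_cover I q i \<U>) (ltranslate g ` pinned_cover I q i \<U>)) \<le> card \<C>"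
    by (intro cover_number_le fuc) (auto simp: refined_by_def)
  also have "card \<C> \<le> card \<C>1 + card \<C>2 + card \<C>3 + card \<C>4"
    unfolding \<C>_def using card_Un_le by (metis (no_types, lifting) add_le_mono1 order_trans)
  also have "\<dots> \<le> card D + (card I - card D) + (card I - card D) + card \<U> * card \<U>"
  proof (intro add_mono)
    show "card \<C>1 \<le> card D" unfolding \<C>1_def by (rule card_image_le[OF finD])
    have "card \<C>2 \<le> card (I - D)" unfolding \<C>2_def by (rule card_image_le) (use I in auto)
    then show "card \<C>2 \<le> card I - card D" using D(1) finD by (simp add: card_Diff_subset)
    have "card \<C>3 \<le> card (I - \<psi> ` D)" unfolding \<C>3_def by (rule card_image_le) (use I in auto)
    then show "card \<C>3 \<le> card I - card D" using D finD by (simp add: card_Diff_subset card_image)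
    have "card \<C>4 \<le> card (\<U> \<times> \<U>)" unfolding \<C>4_def by (rule card_image_le) (use finite_cover in auto)
    then show "card \<C>4 \<le> card \<U> * card \<U>" by (simp add: card_cartesian_product)
  qed
  finally show ?thesis using card_mono[OF I D(1)] by linarith
qed

lemma cover_number_pinned_join_zero_le:
  "cover_number (join_cover (pinned_cover I q i \<U>) (ltranslate 0 ` pinned_cover I q i \<U>))
    \<le> card I + card \<U>"
proof -
  have "ltranslate 0 ` \<V> = \<V>" for \<V> :: "'a set set"
    by (simp add: ltranslate_def)
  then have "cover_number (join_cover (pinned_cover I q i \<U>) (ltranslate 0 ` pinned_cover I q i \<U>))
      \<le> card (pinned_cover I q i \<U>)"
    by (intro cover_number_le pinned_cover_fin_uniform) (simp add: join_cover_least refined_by_refl)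
  also have "\<dots> \<le> card (pinned_member I q i ` I) + card ((\<lambda>U. U - q ` I) ` \<U>)"
    unfolding pinned_cover_def by (rule card_Un_le)
  also have "\<dots> \<le> card I + card \<U>"
    by (intro add_mono card_image_le I finite_cover)
  finally show ?thesis .
qed

end

text \<open>
  Replace each point of \<open>F\<close> by \<open>k\<close> nearby points, which is possible because open sets are infinite.
  The copies inherit the matching and can be chosen so that the new set is disjoint from its
  translates by nonzero elements of \<open>E\<close>. For large \<open>k\<close> they outweigh the boundedly many members that
  the pinned covering spends on the rest of the group.
\<close>

lemma cover_from_matching:
  fixes \<U> :: "'a::{topological_group_add, t2_space} set set"
  assumes nd: "\<not> (\<forall>A :: 'a set. open A)" and E: "finite E" and \<U>: "\<U> \<in> fin_uniform_covers"
  obtains Z where "Z \<in> fin_uniform_covers"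
    "\<And>F e. finite F \<Longrightarrow> F \<noteq> {} \<Longrightarrow> e > 0 \<Longrightarrow>
      \<exists>\<V>\<in>fin_uniform_covers. \<U> \<preceq> \<V> \<and>
        (\<forall>g\<in>E. real (cover_number (join_cover \<V> (ltranslate g ` \<V>))) / real (cover_number \<V>)
          \<le> 2 - real (matching_number F (ltranslate g F) Z) / real (card F) + e)"
proof -
  define \<U>0 where "\<U>0 = interior ` \<U>"
  have \<U>0: "\<U>0 \<in> fin_uniform_covers" "\<U> \<preceq> \<U>0" "\<And>U. U \<in> \<U>0 \<Longrightarrow> open U"
    using interior_fin_uniform[OF \<U>] interior_refines by (auto simp: \<U>0_def)
  obtain \<U>1 where \<U>1: "\<U>1 \<in> fin_uniform_covers" "\<U>0 \<preceq> \<U>1"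
    "\<And>W. W \<in> \<U>1 \<Longrightarrow> \<exists>U\<in>\<U>0. \<forall>W'\<in>\<U>1. W \<inter> W' \<noteq> {} \<longrightarrow> W \<union> W' \<subseteq> U"
    using star_refinement[OF \<U>0(1)] by blast
  have "\<exists>U. U \<in> \<U>0 \<and> (\<forall>W\<in>\<U>1. x \<in> W \<longrightarrow> W \<subseteq> U)" for x
  proof -
    obtain W where W: "W \<in> \<U>1" "x \<in> W" using fin_uniform_covers_covers[OF \<U>1(1)] by blast
    then show ?thesis using \<U>1(3)[OF W(1)] by blast
  qed
  \<comment> \<open>The member assigned to a point contains everything that is close to this point with respect to
    \<open>\<U>1\<close>, hence its partners for all \<open>g\<close> in \<open>E\<close> simultaneously.\<close>
  then obtain st where st: "\<And>x. st x \<in> \<U>0" "\<And>x W. W \<in> \<U>1 \<Longrightarrow> x \<in> W \<Longrightarrow> W \<subseteq> st x"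
    by metis
  obtain \<U>2 where \<U>2: "\<U>2 \<in> fin_uniform_covers" "\<U>1 \<preceq> \<U>2"
    "\<And>g. g \<in> E \<Longrightarrow> ltranslate g ` \<U>1 \<preceq> \<U>2"
    using translates_common_refinement[OF \<U>1(1) E] by blast
  define Z where "Z = interior ` \<U>2"
  have Z: "Z \<in> fin_uniform_covers" "\<U>2 \<preceq> Z" "\<And>U. U \<in> Z \<Longrightarrow> open U"
    using interior_fin_uniform[OF \<U>2(1)] interior_refines by (auto simp: Z_def)
  have finZ: "finite Z" using Z(1) by (simp add: fin_uniform_covers_def)
  show ?thesis
  proof (rule that[OF Z(1)])
    fix F :: "'a set" and e :: real
    assume F: "finite F" "F \<noteq> {}" and e: "e > 0"
    define s where "s = card \<U>0 * card \<U>0"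
    obtain k where k: "real s \<le> e * real k" "k > 0"
    proof -
      obtain k where "real s / e < real k" using reals_Archimedean2 by blast
      then have "real s < e * real k" using e by (simp add: field_simps)
      moreover from this have "k > 0" using e by (metis gr0I mult_zero_right of_nat_0 of_nat_less_0_iff)
      ultimately show ?thesis by (intro that) auto
    qed
    define I where "I = F \<times> {..<k}"
    have I: "finite I" "card I = k * card F" using F by (auto simp: I_def card_cartesian_product)
    \<comment> \<open>A copy of \<open>x\<close> and its translates by \<open>E\<close> must lie in the same members of \<open>Z\<close> as \<open>x\<close> and its
      translates.\<close>
    define N where "N x = (\<Inter>c\<in>{c\<in>Z. x \<in> c}. c) \<inter> (\<Inter>g\<in>E. \<Inter>c\<in>{c\<in>Z. g + x \<in> c}. {z. g + z \<in> c})" for x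
    have "open (N x)" for x
      unfolding N_def using finZ E Z(3)
      by (intro open_Int open_INT finite_Collect_conjI disjI1 ballI open_ltranslate_vimage) auto
    moreover have "x \<in> N x" for x by (auto simp: N_def)
    ultimately have "infinite (N x)" for x using nondiscrete_open_infinite[OF nd] by blast
    then have "\<exists>q. inj_on q I \<and> (\<forall>p\<in>I. q p \<in> N (fst p)) \<and>
        (\<forall>p\<in>I. \<forall>p'\<in>I. \<forall>g\<in>E. g \<noteq> 0 \<longrightarrow> q p \<noteq> g + q p')"
      using points_in_general_position[OF I(1) E, of "\<lambda>p. N (fst p)"] by blast
    then obtain q where q: "inj_on q I" "\<And>p. p \<in> I \<Longrightarrow> q p \<in> N (fst p)"
      "\<And>p p' g. p \<in> I \<Longrightarrow> p' \<in> I \<Longrightarrow> g \<in> E \<Longrightarrow> g \<noteq> 0 \<Longrightarrow> q p \<noteq> g + q p'"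
      by metis
    have st_refl: "q p \<in> st (q p)" for p
      using st(2) fin_uniform_covers_covers[OF \<U>1(1), of "q p"] by blast
    note pc = \<U>0(1,3) I(1) q(1) st(1) st_refl
    define \<V> where "\<V> = pinned_cover I q (\<lambda>p. st (q p)) \<U>0"
    have \<V>: "\<V> \<in> fin_uniform_covers" "\<U>0 \<preceq> \<V>" "card I \<le> cover_number \<V>"
      unfolding \<V>_def
      using pinned_cover_fin_uniform[of \<U>0 I q "\<lambda>p. st (q p)"] pinned_cover_refines[of \<U>0 I q "\<lambda>p. st (q p)"]
        cover_number_pinned_ge[of \<U>0 I q "\<lambda>p. st (q p)"] pc by auto
    have "real (cover_number (join_cover \<V> (ltranslate g ` \<V>))) / real (cover_number \<V>)
          \<le> 2 - real (matching_number F (ltranslate g F) Z) / real (card F) + e" if g: "g \<in> E" for g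
    proof -
      obtain D \<phi> where D: "D \<subseteq> F" "inj_on \<phi> D" "\<phi> ` D \<subseteq> ltranslate g F"
        "\<And>x. x \<in> D \<Longrightarrow> \<exists>U\<in>Z. {x, \<phi> x} \<subseteq> U" "card D = matching_number F (ltranslate g F) Z"
        using matching_number_attained[OF F(1)] by blast
      define D' where "D' = D \<times> {..<k}"
      define \<psi> where "\<psi> p = (- g + \<phi> (fst p), snd p)" for p :: "'a \<times> nat"
      have cardD': "card D' = k * card D" by (simp add: D'_def card_cartesian_product)
      have "cover_number (join_cover \<V> (ltranslate g ` \<V>)) + card D' \<le> 2 * card I + s"
      proof (cases "g = 0")
        \<comment> \<open>For \<open>g = 0\<close> no disjointness is available, but then \<open>\<V>\<close> itself refines the join.\<close>
        case True
        have "cover_number (join_cover \<V> (ltranslate g ` \<V>)) \<le> card I + card \<U>0"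
          unfolding True \<V>_def by (rule cover_number_pinned_join_zero_le) (use pc in auto)
        moreover have "card D' \<le> card I"
          unfolding D'_def I_def using D(1) F by (intro card_mono) auto
        moreover have "card \<U>0 \<le> s" unfolding s_def by simp
        ultimately show ?thesis by linarith
      next
        case False
        have inF: "- g + \<phi> x \<in> F" if "x \<in> D" for x using D(3) that by auto
        have near: "g + q (- g + \<phi> x, j) \<in> st (q (x, j))" "- g + q (x, j) \<in> st (q (- g + \<phi> x, j))"
          if x: "x \<in> D" and j: "j < k" for x j
        proof -
          obtain c where c: "c \<in> Z" "x \<in> c" "\<phi> x \<in> c" using D(4)[OF x] by auto
          have I': "(x, j) \<in> I" "(- g + \<phi> x, j) \<in> I" using x j D(1) inF by (auto simp: I_def)
          have 1: "q (x, j) \<in> c" using q(2)[OF I'(1)] c by (auto simp: N_def)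
          have 2: "g + q (- g + \<phi> x, j) \<in> c" using q(2)[OF I'(2)] c g by (auto simp: N_def)
          obtain c1 where c1: "c1 \<in> \<U>1" "c \<subseteq> c1"
            using refined_by_trans[OF \<U>2(2) Z(2)] c(1) unfolding refined_by_def by blast
          obtain c2 where c2: "c2 \<in> \<U>1" "c \<subseteq> ltranslate g c2"
            using refined_by_trans[OF \<U>2(3)[OF g] Z(2)] c(1) unfolding refined_by_def by blast
          show "g + q (- g + \<phi> x, j) \<in> st (q (x, j))"
            using st(2)[OF c1(1)] 1 2 c1(2) by blast
          have "- g + q (x, j) \<in> c2" using 1 c2(2) by auto
          moreover have "q (- g + \<phi> x, j) \<in> c2"
            using subsetD[OF c2(2) 2] by simp
          ultimately show "- g + q (x, j) \<in> st (q (- g + \<phi> x, j))"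
            using st(2)[OF c2(1)] by blast
        qed
        have inj: "inj_on \<psi> D'"
          using D(2) by (auto simp: inj_on_def \<psi>_def D'_def)
        show ?thesis
          unfolding \<V>_def s_def
          by (rule cover_number_pinned_join_le[where \<psi> = \<psi>])
             (use pc q(3) False g inj near inF D(1) in \<open>auto simp: D'_def \<psi>_def I_def\<close>)
      qed
      then have "real (cover_number (join_cover \<V> (ltranslate g ` \<V>)) + card D') \<le> real (2 * card I + s)"
        by (rule of_nat_mono)
      then have *: "real (cover_number (join_cover \<V> (ltranslate g ` \<V>))) + real k * real (card D)
          \<le> 2 * (real k * real (card F)) + real s"
        unfolding cardD' I(2) by simp
      have cF: "real (card F) \<ge> 1" using F by (simp add: Suc_leI card_gt_0_iff)
      have "(2 - real (card D) / real (card F) + real s / real (k * card F)) * real (card I)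
          = 2 * (real k * real (card F)) - real k * real (card D) + real s"
        using cF k(2) unfolding I(2) by (simp add: field_simps)
      then have le: "real (cover_number (join_cover \<V> (ltranslate g ` \<V>)))
          \<le> (2 - real (card D) / real (card F) + real s / real (k * card F)) * real (card I)"
        using * by linarith
      have cI: "real (card I) > 0" using I(2) F k(2) by (simp add: card_gt_0_iff)
      have "real (cover_number (join_cover \<V> (ltranslate g ` \<V>))) / real (cover_number \<V>)
          \<le> real (cover_number (join_cover \<V> (ltranslate g ` \<V>))) / real (card I)"
        using \<V>(3) cI by (intro divide_left_mono) auto
      also have "\<dots> \<le> 2 - real (card D) / real (card F) + real s / real (k * card F)"
        using le cI by (simp add: divide_le_eq)
      also have "real s / real (k * card F) \<le> real s / real k"
        using cF k(2) by (intro divide_left_mono) auto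
      also have "real s / real k \<le> e" using k by (simp add: divide_le_eq)
      finally show ?thesis using D(5) by simp
    qed
    then show "\<exists>\<V>\<in>fin_uniform_covers. \<U> \<preceq> \<V> \<and>
        (\<forall>g\<in>E. real (cover_number (join_cover \<V> (ltranslate g ` \<V>))) / real (cover_number \<V>)
          \<le> 2 - real (matching_number F (ltranslate g F) Z) / real (card F) + e)"
      using \<V> refined_by_trans[OF \<U>0(2)] by blast
  qed
qed

section \<open>Complexity and matching number\<close>

lemma mean_matching_number_bounds:
  obtains m where "mean_topological_matching_number TYPE('a::topological_group_add) = ereal m" "0 \<le> m" "m \<le> 1"
proof -
  let ?\<mu> = "mean_topological_matching_number TYPE('a)"
  have "0 \<le> ?\<mu>"
    unfolding mean_topological_matching_number_def
  proof (intro INF_greatest)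
    fix E :: "'a set" and \<U> :: "'a set set"
    have "0 \<le> (INF g\<in>E. ereal (real (matching_number {0} (ltranslate g {0}) \<U>) / real (card {0::'a})))"
      by (intro INF_greatest) simp
    also have "\<dots> \<le> (SUP F\<in>{F. finite F \<and> F \<noteq> {}}.
        INF g\<in>E. ereal (real (matching_number F (ltranslate g F) \<U>) / real (card F)))"
      by (rule SUP_upper) simp
    finally show "0 \<le> (SUP F\<in>{F. finite F \<and> F \<noteq> {}}.
        INF g\<in>E. ereal (real (matching_number F (ltranslate g F) \<U>) / real (card F)))" .
  qed
  moreover have "?\<mu> \<le> 1"
    unfolding mean_topological_matching_number_def
  proof (rule INF_lower2[of "{0}"], simp, rule INF_lower2[OF UNIV_fin_uniform_cover], intro SUP_least)
    fix F :: "'a set" assume "F \<in> {F. finite F \<and> F \<noteq> {}}"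
    then have F: "finite F" "card F > 0" by (auto simp: card_gt_0_iff)
    have "real (matching_number F (ltranslate 0 F) {UNIV}) / real (card F) \<le> 1"
      using matching_number_le[OF F(1)] F(2) by (simp add: divide_le_eq_1)
    then show "(INF g\<in>{0}. ereal (real (matching_number F (ltranslate g F) {UNIV}) / real (card F))) \<le> 1"
      by simp
  qed
  ultimately show ?thesis using that
    by (cases ?\<mu>) (auto simp: one_ereal_def)
qed

lemma complexity_le:
  assumes nd: "\<not> (\<forall>A :: 'a::{topological_group_add, t2_space} set. open A)"
    and m: "mean_topological_matching_number TYPE('a) = ereal m"
  shows "asymptotic_uniform_complexity TYPE('a) \<le> ereal (2 - m)"
  unfolding asymptotic_uniform_complexity_def
proof (intro SUP_least)
  fix E :: "'a set" and \<U> :: "'a set set"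
  assume "E \<in> {E. finite E}" and \<U>: "\<U> \<in> fin_uniform_covers"
  then have E: "finite E" by simp
  let ?inf = "INF \<V>\<in>{\<V> \<in> fin_uniform_covers. \<U> \<preceq> \<V>}.
      SUP g\<in>E. ereal (real (cover_number (join_cover \<V> (ltranslate g ` \<V>))) / real (cover_number \<V>))"
  obtain Z where Z: "Z \<in> fin_uniform_covers"
    "\<And>F e. finite F \<Longrightarrow> F \<noteq> {} \<Longrightarrow> e > 0 \<Longrightarrow>
      \<exists>\<V>\<in>fin_uniform_covers. \<U> \<preceq> \<V> \<and>
        (\<forall>g\<in>E. real (cover_number (join_cover \<V> (ltranslate g ` \<V>))) / real (cover_number \<V>)
          \<le> 2 - real (matching_number F (ltranslate g F) Z) / real (card F) + e)"
    using cover_from_matching[OF nd E \<U>] by blast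
  show "?inf \<le> ereal (2 - m)"
  proof (rule ereal_le_epsilon2)
    fix e :: real assume e: "0 < e"
    have "ereal m \<le> (SUP F\<in>{F. finite F \<and> F \<noteq> {}}.
        INF g\<in>E. ereal (real (matching_number F (ltranslate g F) Z) / real (card F)))"
      unfolding m[symmetric] mean_topological_matching_number_def
      using E Z(1) by (intro INF_lower2[of E] INF_lower2[of Z]) auto
    moreover have "ereal (m - e / 2) < ereal m" using e by simp
    ultimately have "ereal (m - e / 2) < (SUP F\<in>{F. finite F \<and> F \<noteq> {}}.
        INF g\<in>E. ereal (real (matching_number F (ltranslate g F) Z) / real (card F)))"
      by (rule less_le_trans[rotated])
    then obtain F where F: "finite F" "F \<noteq> {}"
      and FE: "ereal (m - e / 2) < (INF g\<in>E. ereal (real (matching_number F (ltranslate g F) Z) / real (card F)))"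
      unfolding less_SUP_iff by blast
    have mg: "m - e / 2 < real (matching_number F (ltranslate g F) Z) / real (card F)" if "g \<in> E" for g
      using less_INF_D[OF FE that] by simp
    obtain \<V> where \<V>: "\<V> \<in> fin_uniform_covers" "\<U> \<preceq> \<V>"
      "\<And>g. g \<in> E \<Longrightarrow> real (cover_number (join_cover \<V> (ltranslate g ` \<V>))) / real (cover_number \<V>)
          \<le> 2 - real (matching_number F (ltranslate g F) Z) / real (card F) + e / 2"
      using Z(2)[OF F half_gt_zero[OF e]] by blast
    have "?inf \<le> (SUP g\<in>E. ereal (real (cover_number (join_cover \<V> (ltranslate g ` \<V>))) / real (cover_number \<V>)))"
      using \<V> by (intro INF_lower) auto
    also have "\<dots> \<le> ereal (2 - m + e)"
    proof (intro SUP_least)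
      fix g assume "g \<in> E"
      from mg[OF this] \<V>(3)[OF this]
      show "ereal (real (cover_number (join_cover \<V> (ltranslate g ` \<V>))) / real (cover_number \<V>)) \<le> ereal (2 - m + e)"
        by simp
    qed
    finally show "?inf \<le> ereal (2 - m) + ereal e" by simp
  qed
qed

lemma complexity_ge:
  assumes nd: "\<not> (\<forall>A :: 'a::{topological_group_add, t2_space} set. open A)"
    and m: "mean_topological_matching_number TYPE('a) = ereal m"
  shows "ereal (2 - m) \<le> asymptotic_uniform_complexity TYPE('a)"
proof (rule ccontr)
  assume "\<not> ereal (2 - m) \<le> asymptotic_uniform_complexity TYPE('a)"
  then have "asymptotic_uniform_complexity TYPE('a) < ereal (2 - m)" by simp
  then obtain w where w: "asymptotic_uniform_complexity TYPE('a) < ereal w" "w < 2 - m"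
    using ereal_dense2 by (metis ereal_less_eq(3) less_ereal.simps(1))
  have "ereal (2 - w) \<le> mean_topological_matching_number TYPE('a)"
    unfolding mean_topological_matching_number_def
  proof (intro INF_greatest)
    fix E :: "'a set" and \<U> :: "'a set set"
    assume "E \<in> {E. finite E}" and \<U>: "\<U> \<in> fin_uniform_covers"
    then have E: "finite E" by simp
    obtain \<U>' where \<U>': "\<U>' \<in> fin_uniform_covers"
      "\<And>\<V>. \<V> \<in> fin_uniform_covers \<Longrightarrow> \<U>' \<preceq> \<V> \<Longrightarrow>
        \<exists>F. finite F \<and> card F = cover_number \<V> \<and>
          (\<forall>g\<in>E. 2 * card F \<le>
            matching_number F (ltranslate g F) \<U> + cover_number (join_cover \<V> (ltranslate g ` \<V>)))"
      using matching_from_cover[OF nd E \<U>] by blast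
    have "(INF \<V>\<in>{\<V> \<in> fin_uniform_covers. \<U>' \<preceq> \<V>}.
        SUP g\<in>E. ereal (real (cover_number (join_cover \<V> (ltranslate g ` \<V>))) / real (cover_number \<V>)))
        \<le> asymptotic_uniform_complexity TYPE('a)"
      unfolding asymptotic_uniform_complexity_def
      using E \<U>'(1) by (intro SUP_upper2[of E] SUP_upper2[of \<U>']) auto
    from le_less_trans[OF this w(1)]
    obtain \<V> where \<V>: "\<V> \<in> fin_uniform_covers" "\<U>' \<preceq> \<V>"
      and lt: "(SUP g\<in>E. ereal (real (cover_number (join_cover \<V> (ltranslate g ` \<V>))) / real (cover_number \<V>))) < ereal w"
      unfolding INF_less_iff by blast
    obtain F where F: "finite F" "card F = cover_number \<V>"
      "\<And>g. g \<in> E \<Longrightarrow> 2 * card F \<le>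
            matching_number F (ltranslate g F) \<U> + cover_number (join_cover \<V> (ltranslate g ` \<V>))"
      using \<U>'(2)[OF \<V>] by blast
    have cF: "card F > 0" using F(2) cover_number_pos[OF \<V>(1)] by simp
    then have "F \<noteq> {}" by auto
    have "ereal (2 - w) \<le> (INF g\<in>E. ereal (real (matching_number F (ltranslate g F) \<U>) / real (card F)))"
    proof (intro INF_greatest)
      fix g assume g: "g \<in> E"
      have "real (cover_number (join_cover \<V> (ltranslate g ` \<V>))) / real (card F) < w"
        using SUP_lessD[OF lt g] F(2) by simp
      moreover have "real (2 * card F) \<le> real (matching_number F (ltranslate g F) \<U>
          + cover_number (join_cover \<V> (ltranslate g ` \<V>)))"
        using F(3)[OF g] by (rule of_nat_mono)
      ultimately show "ereal (2 - w) \<le> ereal (real (matching_number F (ltranslate g F) \<U>) / real (card F))"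
        using cF by (simp add: field_simps)
    qed
    also have "\<dots> \<le> (SUP F\<in>{F. finite F \<and> F \<noteq> {}}.
        INF g\<in>E. ereal (real (matching_number F (ltranslate g F) \<U>) / real (card F)))"
      using F(1) \<open>F \<noteq> {}\<close> by (intro SUP_upper) auto
    finally show "ereal (2 - w) \<le> (SUP F\<in>{F. finite F \<and> F \<noteq> {}}.
        INF g\<in>E. ereal (real (matching_number F (ltranslate g F) \<U>) / real (card F)))" .
  qed
  then show False using m w(2) by simp
qed

section \<open>Right uniformly continuous functions\<close>

lemma UC_b_iff:
  "f \<in> UC_b \<longleftrightarrow> (\<exists>B. \<forall>x. \<bar>f x\<bar> \<le> B) \<and>
    (\<forall>e>0. \<exists>V. open V \<and> 0 \<in> V \<and> (\<forall>v\<in>V. \<forall>x. \<bar>f (v + x) - f x\<bar> < e))"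
proof -
  have "bounded (range f) \<longleftrightarrow> (\<exists>B. \<forall>x. \<bar>f x\<bar> \<le> B)"
    by (auto simp: bounded_iff)
  moreover have "right_uniformly_continuous f \<longleftrightarrow>
    (\<forall>e>0. \<exists>V. open V \<and> 0 \<in> V \<and> (\<forall>v\<in>V. \<forall>x. \<bar>f (v + x) - f x\<bar> < e))" (is "?L \<longleftrightarrow> ?R")
  proof
    assume L: ?L
    show ?R
    proof (intro allI impI)
      fix e :: real assume e: "0 < e"
      have "real_uniform_cover (range (\<lambda>y. ball y (e / 2)))"
        unfolding real_uniform_cover_def using e refined_by_refl by (intro exI[of _ "e / 2"]) auto
      then have "right_uniform_cover {f -` U | U. U \<in> range (\<lambda>y. ball y (e / 2))}"
        using L unfolding right_uniformly_continuous_def by blast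
      then obtain V where V: "open V" "0 \<in> V"
        "\<And>x. \<exists>U\<in>{f -` U | U. U \<in> range (\<lambda>y. ball y (e / 2))}. \<forall>v\<in>V. v + x \<in> U"
        unfolding right_uniform_cover_iff by blast
      have "\<bar>f (v + x) - f x\<bar> < e" if v: "v \<in> V" for v x
      proof -
        obtain y where "\<forall>v\<in>V. f (v + x) \<in> ball y (e / 2)" using V(3)[of x] by auto
        then have "f (v + x) \<in> ball y (e / 2)" "f (0 + x) \<in> ball y (e / 2)" using v V(2) by blast+
        then show ?thesis unfolding mem_ball dist_real_def add_0 by linarith
      qed
      then show "\<exists>V. open V \<and> 0 \<in> V \<and> (\<forall>v\<in>V. \<forall>x. \<bar>f (v + x) - f x\<bar> < e)" using V by blast
    qed
  next
    assume R: ?R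
    show ?L
      unfolding right_uniformly_continuous_def
    proof (intro allI impI)
      fix \<U> assume "real_uniform_cover \<U>"
      then obtain r where r: "r > 0" "\<U> \<preceq> range (\<lambda>x. ball x r)" by (auto simp: real_uniform_cover_def)
      obtain V where V: "open V" "0 \<in> V" "\<And>v x. v \<in> V \<Longrightarrow> \<bar>f (v + x) - f x\<bar> < r"
        using R[rule_format, OF r(1)] by metis
      have "\<exists>U\<in>{f -` U | U. U \<in> \<U>}. \<forall>v\<in>V. v + x \<in> U" for x
      proof -
        obtain U where U: "U \<in> \<U>" "ball (f x) r \<subseteq> U" using r(2) unfolding refined_by_def by blast
        have "f (v + x) \<in> U" if "v \<in> V" for v
          using V(3)[OF that, of x] by (intro subsetD[OF U(2)]) (auto simp: dist_real_def)
        then show ?thesis using U(1) by blast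
      qed
      then show "right_uniform_cover {f -` U | U. U \<in> \<U>}"
        unfolding right_uniform_cover_iff using V(1,2) by blast
    qed
  qed
  ultimately show ?thesis by (simp add: UC_b_def)
qed

lemma UC_b_bounded:
  assumes "f \<in> UC_b"
  obtains B where "B \<ge> 0" "\<And>x. \<bar>f x\<bar> \<le> B"
proof -
  obtain B where "\<forall>x. \<bar>f x\<bar> \<le> B" using assms by (auto simp: UC_b_iff)
  then show ?thesis using that[of B] by (meson abs_ge_zero order_trans)
qed

lemma UC_b_bdd:
  assumes "f \<in> UC_b"
  shows "bdd_above (range f)" "bdd_below (range f)"
proof -
  obtain B where "\<And>x. \<bar>f x\<bar> \<le> B" using UC_b_bounded[OF assms] by blast
  then have "f x \<le> B" "- B \<le> f x" for x by (simp_all add: abs_le_iff minus_le_iff)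
  then show "bdd_above (range f)" "bdd_below (range f)" by (auto simp: bdd_above_def bdd_below_def)
qed

lemma UC_b_uniform:
  assumes "f \<in> UC_b" "e > 0"
  obtains V where "open V" "0 \<in> V" "\<And>v x. v \<in> V \<Longrightarrow> \<bar>f (v + x) - f x\<bar> < e"
proof -
  from iffD1[OF UC_b_iff assms(1), THEN conjunct2, rule_format, OF assms(2)]
  obtain V where "open V \<and> 0 \<in> V \<and> (\<forall>v\<in>V. \<forall>x. \<bar>f (v + x) - f x\<bar> < e)" ..
  then show ?thesis using that by blast
qed

lemma UC_b_const: "(\<lambda>x. c) \<in> UC_b"
  unfolding UC_b_iff by (auto intro!: exI[of _ UNIV])

lemma UC_b_add:
  assumes "f \<in> UC_b" "h \<in> UC_b"
  shows "(\<lambda>x. f x + h x) \<in> UC_b"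
  unfolding UC_b_iff
proof (intro conjI allI impI)
  obtain B where "\<And>x. \<bar>f x\<bar> \<le> B" using UC_b_bounded[OF assms(1)] by blast
  moreover obtain C where "\<And>x. \<bar>h x\<bar> \<le> C" using UC_b_bounded[OF assms(2)] by blast
  ultimately have "\<bar>f x + h x\<bar> \<le> B + C" for x by (meson abs_triangle_ineq add_mono order_trans)
  then show "\<exists>B. \<forall>x. \<bar>f x + h x\<bar> \<le> B" by blast
  fix e :: real assume e: "e > 0"
  obtain V where V: "open V" "0 \<in> V" "\<And>v x. v \<in> V \<Longrightarrow> \<bar>f (v + x) - f x\<bar> < e / 2"
    using UC_b_uniform[OF assms(1) half_gt_zero[OF e]] by blast
  obtain W where W: "open W" "0 \<in> W" "\<And>v x. v \<in> W \<Longrightarrow> \<bar>h (v + x) - h x\<bar> < e / 2"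
    using UC_b_uniform[OF assms(2) half_gt_zero[OF e]] by blast
  have "\<bar>f (v + x) + h (v + x) - (f x + h x)\<bar> < e" if "v \<in> V \<inter> W" for v x
  proof -
    have "\<bar>f (v + x) - f x\<bar> < e / 2" "\<bar>h (v + x) - h x\<bar> < e / 2" using V(3) W(3) that by blast+
    then show ?thesis by linarith
  qed
  then show "\<exists>V. open V \<and> 0 \<in> V \<and> (\<forall>v\<in>V. \<forall>x. \<bar>f (v + x) + h (v + x) - (f x + h x)\<bar> < e)"
    using V W by (intro exI[of _ "V \<inter> W"]) auto
qed

lemma UC_b_scale:
  assumes "f \<in> UC_b"
  shows "(\<lambda>x. c * f x) \<in> UC_b"
  unfolding UC_b_iff
proof (intro conjI allI impI)
  obtain B where "\<And>x. \<bar>f x\<bar> \<le> B" using UC_b_bounded[OF assms] by blast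
  then have "\<bar>c * f x\<bar> \<le> \<bar>c\<bar> * B" for x by (simp add: abs_mult mult_left_mono)
  then show "\<exists>B. \<forall>x. \<bar>c * f x\<bar> \<le> B" by blast
  fix e :: real assume e: "e > 0"
  have "e / (\<bar>c\<bar> + 1) > 0" using e by simp
  then obtain V where V: "open V" "0 \<in> V" "\<And>v x. v \<in> V \<Longrightarrow> \<bar>f (v + x) - f x\<bar> < e / (\<bar>c\<bar> + 1)"
    using UC_b_uniform[OF assms] by blast
  have "\<bar>c * f (v + x) - c * f x\<bar> < e" if "v \<in> V" for v x
  proof -
    have "\<bar>c * f (v + x) - c * f x\<bar> = \<bar>c\<bar> * \<bar>f (v + x) - f x\<bar>"
      by (simp add: abs_mult flip: right_diff_distrib)
    also have "\<dots> \<le> (\<bar>c\<bar> + 1) * \<bar>f (v + x) - f x\<bar>" by (intro mult_right_mono) auto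
    also have "\<dots> < e" using V(3)[OF that, of x] by (simp add: field_simps)
    finally show ?thesis .
  qed
  then show "\<exists>V. open V \<and> 0 \<in> V \<and> (\<forall>v\<in>V. \<forall>x. \<bar>c * f (v + x) - c * f x\<bar> < e)"
    using V by blast
qed

lemma UC_b_ltranslate:
  assumes "f \<in> UC_b"
  shows "f \<circ> (\<lambda>x. g + x) \<in> UC_b"
  unfolding UC_b_iff
proof (intro conjI allI impI)
  obtain B where "\<And>x. \<bar>f x\<bar> \<le> B" using UC_b_bounded[OF assms] by blast
  then show "\<exists>B. \<forall>x. \<bar>(f \<circ> (\<lambda>x. g + x)) x\<bar> \<le> B" by auto
  fix e :: real assume e: "e > 0"
  obtain V where V: "open V" "0 \<in> V" "\<And>v x. v \<in> V \<Longrightarrow> \<bar>f (v + x) - f x\<bar> < e"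
    using UC_b_uniform[OF assms e] by blast
  have "open {x. g + x \<in> {y. y + - g \<in> V}}"
    by (intro open_ltranslate_vimage open_rtranslate_vimage V)
  then have op: "open {x. g + x + - g \<in> V}" by simp
  have "\<bar>f (g + (v + x)) - f (g + x)\<bar> < e" if "g + v + - g \<in> V" for v x
    using V(3)[OF that, of "g + x"] by (simp add: add.assoc del: add_uminus_conv_diff)
  then show "\<exists>V. open V \<and> 0 \<in> V \<and>
      (\<forall>v\<in>V. \<forall>x. \<bar>(f \<circ> (\<lambda>x. g + x)) (v + x) - (f \<circ> (\<lambda>x. g + x)) x\<bar> < e)"
    using op V(2) by (intro exI[of _ "{x. g + x + - g \<in> V}"]) (auto simp del: add_uminus_conv_diff)
qed

lemma UC_b_sum:
  assumes "\<And>i. i \<in> I \<Longrightarrow> f i \<in> UC_b"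
  shows "(\<lambda>x. \<Sum>i\<in>I. f i x) \<in> UC_b"
  using assms by (induction I rule: infinite_finite_induct) (auto intro: UC_b_const UC_b_add)

lemma UC_b_open_less:
  assumes "f \<in> UC_b"
  shows "open {x. f x < c}"
proof (subst open_subopen, rule ballI)
  fix x assume "x \<in> {x. f x < c}"
  then have "c - f x > 0" by simp
  then obtain V where V: "open V" "0 \<in> V" "\<And>v y. v \<in> V \<Longrightarrow> \<bar>f (v + y) - f y\<bar> < c - f x"
    using UC_b_uniform[OF assms] by blast
  have "f y < c" if "y + - x \<in> V" for y
    using V(3)[OF that, of x] by (simp add: abs_less_iff)
  moreover have "open {y. y + - x \<in> V}" using V(1) by (rule open_rtranslate_vimage)
  ultimately show "\<exists>T. open T \<and> x \<in> T \<and> T \<subseteq> {x. f x < c}"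
    using V(2) by (intro exI[of _ "{y. y + - x \<in> V}"]) auto
qed

lemma UC_b_small_oscillation_cover:
  assumes f: "f \<in> UC_b" and e: "e > 0"
  shows "\<exists>\<U>\<in>fin_uniform_covers. \<forall>U\<in>\<U>. \<forall>x\<in>U. \<forall>y\<in>U. \<bar>f x - f y\<bar> \<le> e"
proof -
  \<comment> \<open>The level sets of \<open>f\<close> around the multiples of \<open>d\<close> have radius \<open>2 d\<close>, so they overlap by enough
    to contain a \<open>d\<close>-neighborhood of each value.\<close>
  define d where "d = e / 4"
  have d: "d > 0" using e by (simp add: d_def)
  obtain B where B: "\<And>x. \<bar>f x\<bar> \<le> B" using UC_b_bounded[OF f] by blast
  obtain V where V: "open V" "0 \<in> V" "\<And>v x. v \<in> V \<Longrightarrow> \<bar>f (v + x) - f x\<bar> < d"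
    using UC_b_uniform[OF f d] by blast
  define A where "A k = {x. \<bar>f x - of_int k * d\<bar> \<le> 2 * d}" for k :: int
  define \<U> where "\<U> = A ` {\<lfloor>- B / d\<rfloor>..\<lfloor>B / d\<rfloor>}"
  have "\<U> \<in> fin_uniform_covers"
  proof (rule fin_uniform_coversI[OF _ V(1,2)])
    fix x
    define k where "k = \<lfloor>f x / d\<rfloor>"
    have "- B \<le> f x" "f x \<le> B" using B[of x] by (simp_all add: abs_le_iff minus_le_iff)
    then have "- B / d \<le> f x / d" "f x / d \<le> B / d" using d by (intro divide_right_mono; simp)+
    then have k: "k \<in> {\<lfloor>- B / d\<rfloor>..\<lfloor>B / d\<rfloor>}"
      unfolding k_def by (simp add: floor_mono del: minus_divide_left)
    have "of_int k \<le> f x / d" "f x / d < of_int k + 1" unfolding k_def by linarith+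
    then have "of_int k * d \<le> f x" "f x < (of_int k + 1) * d" using d by (simp_all add: field_simps)
    then have fx: "\<bar>f x - of_int k * d\<bar> \<le> d" by (simp add: algebra_simps)
    have "v + x \<in> A k" if "v \<in> V" for v
      using V(3)[OF that, of x] fx unfolding A_def by simp
    then show "\<exists>U\<in>\<U>. \<forall>v\<in>V. v + x \<in> U" unfolding \<U>_def using k by blast
  qed (simp add: \<U>_def)
  moreover have "\<bar>f x - f y\<bar> \<le> e" if U: "U \<in> \<U>" "x \<in> U" "y \<in> U" for U x y
  proof -
    obtain k where "U = A k" using U by (auto simp: \<U>_def)
    then have "\<bar>f x - of_int k * d\<bar> \<le> 2 * d" "\<bar>f y - of_int k * d\<bar> \<le> 2 * d" using U by (auto simp: A_def)
    then show ?thesis unfolding d_def by linarith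
  qed
  ultimately show ?thesis by blast
qed

lemma UC_b_finite_small_oscillation_cover:
  assumes "finite H" "H \<subseteq> UC_b" "e > 0"
  obtains \<U> where "\<U> \<in> fin_uniform_covers"
    "\<And>f U x y. f \<in> H \<Longrightarrow> U \<in> \<U> \<Longrightarrow> x \<in> U \<Longrightarrow> y \<in> U \<Longrightarrow> \<bar>f x - f y\<bar> \<le> e"
proof -
  obtain c where c: "\<And>f. f \<in> H \<Longrightarrow> c f \<in> fin_uniform_covers \<and> (\<forall>U\<in>c f. \<forall>x\<in>U. \<forall>y\<in>U. \<bar>f x - f y\<bar> \<le> e)"
    using UC_b_small_oscillation_cover[OF _ assms(3)] assms(2) by (metis subsetD)
  have "\<exists>\<W>\<in>fin_uniform_covers. \<forall>\<U>\<in>c ` H. \<U> \<preceq> \<W>"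
    using assms(1) c by (intro common_refinement) auto
  then obtain \<W> where \<W>: "\<W> \<in> fin_uniform_covers" "\<And>f. f \<in> H \<Longrightarrow> c f \<preceq> \<W>" by auto
  show ?thesis
  proof (rule that[OF \<W>(1)])
    fix f U x y assume *: "f \<in> H" "U \<in> \<W>" "x \<in> U" "y \<in> U"
    obtain U' where "U' \<in> c f" "U \<subseteq> U'" using \<W>(2)[OF *(1)] *(2) by (auto simp: refined_by_def)
    then show "\<bar>f x - f y\<bar> \<le> e" using c[OF *(1)] * by blast
  qed
qed

section \<open>A uniform Urysohn lemma\<close>

text \<open>
  Let \<open>W\<close> be a sequence of sets with \<open>W (n + 1) + W (n + 1) + W (n + 1) \<subseteq> W n\<close>, and give an element of
  \<open>W k\<close> the weight \<open>2\<^sup>-\<^sup>k\<close>. A sum of total weight below \<open>2\<^sup>-\<^sup>n\<close> lies in \<open>W n\<close>: cut it at the summand that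
  crosses half of the total weight, so that both remaining parts lie in \<open>W (n + 1)\<close> by induction,
  and so does the summand. This is the standard step in the Birkhoff-Kakutani metrization theorem.
\<close>

definition chain_weight :: "('a \<times> nat) list \<Rightarrow> real"
  where "chain_weight xs = (\<Sum>(v, k)\<leftarrow>xs. (1 / 2) ^ k)"

definition chain_value :: "('a::monoid_add \<times> nat) list \<Rightarrow> 'a"
  where "chain_value xs = sum_list (map fst xs)"

lemma chain_weight_simps [simp]:
  "chain_weight [] = 0" "chain_weight ((v, k) # xs) = (1 / 2) ^ k + chain_weight xs"
  "chain_weight (xs @ ys) = chain_weight xs + chain_weight ys"
  by (simp_all add: chain_weight_def)

lemma chain_value_simps [simp]:
  "chain_value [] = 0" "chain_value ((v, k) # xs) = v + chain_value xs"
  "chain_value (xs @ ys) = chain_value xs + chain_value ys"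
  by (simp_all add: chain_value_def)

lemma chain_weight_nonneg: "0 \<le> chain_weight xs"
  by (induction xs) auto

lemma chain_split:
  assumes "xs \<noteq> []" "0 \<le> c" "c \<le> chain_weight xs"
  shows "\<exists>ys v k zs. xs = ys @ (v, k) # zs \<and> chain_weight ys \<le> c \<and> c \<le> chain_weight ys + (1 / 2) ^ k"
  using assms
proof (induction xs arbitrary: c)
  case (Cons p xs)
  obtain v k where p: "p = (v, k)" by (cases p)
  show ?case
  proof (cases "c \<le> (1 / 2) ^ k")
    case True
    then show ?thesis using Cons.prems p by (intro exI[of _ "[]"]) auto
  next
    case False
    then have "xs \<noteq> []" using Cons.prems p by auto
    moreover have "0 \<le> c - (1 / 2) ^ k" "c - (1 / 2) ^ k \<le> chain_weight xs" using False Cons.prems p by auto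
    ultimately obtain ys w j zs where "xs = ys @ (w, j) # zs" "chain_weight ys \<le> c - (1 / 2) ^ k"
      "c - (1 / 2) ^ k \<le> chain_weight ys + (1 / 2) ^ j"
      using Cons.IH by blast
    then show ?thesis using p by (intro exI[of _ "p # ys"] exI[of _ w] exI[of _ j] exI[of _ zs]) auto
  qed
qed simp

lemma chain_value_in:
  fixes W :: "nat \<Rightarrow> 'a::monoid_add set"
  assumes W0: "\<And>n. 0 \<in> W n"
    and W3: "\<And>n a b c. a \<in> W (Suc n) \<Longrightarrow> b \<in> W (Suc n) \<Longrightarrow> c \<in> W (Suc n) \<Longrightarrow> a + b + c \<in> W n"
    and "\<And>v k. (v, k) \<in> set xs \<Longrightarrow> v \<in> W k" "chain_weight xs < (1 / 2) ^ n"
  shows "chain_value xs \<in> W n"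
  using assms(3,4)
proof (induction "length xs" arbitrary: xs n rule: less_induct)
  case less
  have "W (Suc n) \<subseteq> W n" for n using W3[OF _ W0 W0] by auto
  then have mono: "W n \<subseteq> W m" if "m \<le> n" for m n by (rule lift_Suc_antimono_le[of W]) (use that in auto)
  show ?case
  proof (cases "xs = []")
    case False
    define a where "a = chain_weight xs"
    have a: "0 \<le> a" "a < (1 / 2) ^ n" using less.prems(2) chain_weight_nonneg by (auto simp: a_def)
    obtain ys v k zs where xs: "xs = ys @ (v, k) # zs" "chain_weight ys \<le> a / 2"
      "a / 2 \<le> chain_weight ys + (1 / 2) ^ k"
      using chain_split[OF False, of "a / 2"] a(1) by (auto simp: a_def)
    have tot: "a = chain_weight ys + (1 / 2) ^ k + chain_weight zs" by (simp add: a_def xs(1))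
    have half: "a / 2 < (1 / 2) ^ Suc n" using a(2) by simp
    have "chain_value ys \<in> W (Suc n)"
      using less.prems(1) half xs by (intro less.hyps) auto
    moreover have "chain_value zs \<in> W (Suc n)"
      using less.prems(1) half xs tot by (intro less.hyps) auto
    moreover have "v \<in> W (Suc n)"
    proof -
      have "(1 / 2 :: real) ^ k \<le> a" using tot chain_weight_nonneg[of ys] chain_weight_nonneg[of zs] by linarith
      then have "(1 / 2 :: real) ^ k < (1 / 2) ^ n" using a(2) by linarith
      then have "n < k"
        using power_decreasing[of k n "1 / 2 :: real"] by (cases "n < k") auto
      then show ?thesis using less.prems(1)[of v k] xs(1) mono[of "Suc n" k] by auto
    qed
    ultimately have "chain_value ys + v + chain_value zs \<in> W n" by (intro W3)
    then show ?thesis by (simp add: xs(1) add.assoc)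
  qed (simp add: W0)
qed

text \<open>
  The separating function is \<open>1\<close> minus the distance to \<open>T\<close>, measured by the least weight of a sum
  that leads from \<open>T\<close> to the point, cut off at \<open>1\<close>. Prepending one more element of \<open>W n\<close> changes the
  distance by at most \<open>2\<^sup>-\<^sup>n\<close>, which is uniform continuity.
\<close>

lemma uniform_urysohn:
  fixes S T :: "'a::topological_group_add set"
  assumes S: "open S" "0 \<in> S"
  obtains f where "f \<in> UC_b" "\<And>x. 0 \<le> f x" "\<And>x. f x \<le> 1" "\<And>x. x \<in> T \<Longrightarrow> f x = 1"
    "\<And>x. f x \<noteq> 0 \<Longrightarrow> \<exists>t\<in>T. \<exists>v\<in>S. x = v + t"
proof -
  have "\<exists>W. \<forall>n. (open (W n) \<and> 0 \<in> W n \<and> (n = 0 \<longrightarrow> W n \<subseteq> S)) \<and>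
      (\<forall>a\<in>W (Suc n). \<forall>b\<in>W (Suc n). \<forall>c\<in>W (Suc n). a + b + c \<in> W n) "
  proof (rule dependent_nat_choice)
    show "\<exists>A. open A \<and> 0 \<in> A \<and> (0 = (0::nat) \<longrightarrow> A \<subseteq> S)" using S by blast
    fix A and n :: nat assume "open A \<and> 0 \<in> A \<and> (n = 0 \<longrightarrow> A \<subseteq> S)"
    then obtain P where "open P" "0 \<in> P" "\<And>a b c. a \<in> P \<Longrightarrow> b \<in> P \<Longrightarrow> c \<in> P \<Longrightarrow> a + b + c \<in> A"
      using nbhd_zero_sum3 by metis
    then show "\<exists>B. (open B \<and> 0 \<in> B \<and> (Suc n = 0 \<longrightarrow> B \<subseteq> S)) \<and> (\<forall>a\<in>B. \<forall>b\<in>B. \<forall>c\<in>B. a + b + c \<in> A)"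
      by blast
  qed
  then obtain W where W: "\<And>n. open (W n)" "\<And>n. 0 \<in> W n" "W 0 \<subseteq> S"
    "\<And>n a b c. a \<in> W (Suc n) \<Longrightarrow> b \<in> W (Suc n) \<Longrightarrow> c \<in> W (Suc n) \<Longrightarrow> a + b + c \<in> W n"
    by metis
  \<comment> \<open>Inserting \<open>1\<close> cuts the distance off at \<open>1\<close> and takes care of the case that \<open>R y\<close> is empty.\<close>
  define R where "R y = {chain_weight xs | xs. (\<forall>(v, k)\<in>set xs. v \<in> W k) \<and> (\<exists>t\<in>T. y = chain_value xs + t)}" for y
  define d where "d y = Inf (insert 1 (R y))" for y
  have Rpos: "0 \<le> r" if "r \<in> insert 1 (R y)" for r y
    using that chain_weight_nonneg by (auto simp: R_def)
  have bdd: "bdd_below (insert 1 (R y))" for y using Rpos by (meson bdd_belowI)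
  have d0: "0 \<le> d y" for y unfolding d_def by (rule cInf_greatest) (use Rpos in auto)
  have d1: "d y \<le> 1" for y unfolding d_def by (rule cInf_lower[OF _ bdd]) simp
  have dT: "d y = 0" if "y \<in> T" for y
  proof -
    have "0 \<in> R y" unfolding R_def using that by (intro CollectI exI[of _ "[]"]) auto
    then have "d y \<le> 0" unfolding d_def by (intro cInf_lower[OF _ bdd]) simp
    then show ?thesis using d0[of y] by simp
  qed
  have dS: "\<exists>t\<in>T. \<exists>v\<in>S. y = v + t" if dy: "d y < 1" for y
  proof -
    obtain r where "r \<in> insert 1 (R y)" "r < 1"
      using dy unfolding d_def by (subst (asm) cInf_less_iff) (use bdd in auto)
    then obtain xs t where xs: "\<forall>(v, k)\<in>set xs. v \<in> W k" "t \<in> T" "y = chain_value xs + t" "chain_weight xs < 1"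
      by (auto simp: R_def)
    have "chain_value xs \<in> W 0"
      by (rule chain_value_in) (use W xs in auto)
    then show ?thesis using W(3) xs by blast
  qed
  have step: "d (v + y) \<le> (1 / 2) ^ n + d y" if v: "v \<in> W n" for v n y
  proof -
    have "d (v + y) - (1 / 2) ^ n \<le> d y"
      unfolding d_def[of y]
    proof (rule cInf_greatest)
      fix r assume "r \<in> insert 1 (R y)"
      then show "d (v + y) - (1 / 2) ^ n \<le> r"
      proof
        assume "r = 1"
        then show ?thesis using d1[of "v + y"] by (simp add: diff_le_eq add_increasing2)
      next
        assume "r \<in> R y"
        then obtain xs t where xs: "\<forall>(v, k)\<in>set xs. v \<in> W k" "t \<in> T" "y = chain_value xs + t" "r = chain_weight xs"
          by (auto simp: R_def)
        have "(1 / 2) ^ n + r \<in> R (v + y)"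
          unfolding R_def using xs v by (intro CollectI exI[of _ "(v, n) # xs"]) (auto simp: add.assoc)
        then have "d (v + y) \<le> (1 / 2) ^ n + r" unfolding d_def by (intro cInf_lower[OF _ bdd]) simp
        then show ?thesis by simp
      qed
    qed simp
    then show ?thesis by simp
  qed
  define f where "f y = 1 - d y" for y
  have "f \<in> UC_b"
    unfolding UC_b_iff
  proof (intro conjI allI impI)
    have "\<bar>f x\<bar> \<le> 1" for x using d0[of x] d1[of x] by (simp add: f_def)
    then show "\<exists>B. \<forall>x. \<bar>f x\<bar> \<le> B" by blast
    fix e :: real assume "0 < e"
    then obtain n where n: "(1 / 2) ^ n < e" using real_arch_pow_inv[of e "1 / 2"] by auto
    have "\<bar>f (v + x) - f x\<bar> < e" if v: "v \<in> W n \<inter> uminus -` W n" for v x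
    proof -
      have "d (v + x) \<le> (1 / 2) ^ n + d x" using v by (intro step) auto
      moreover have "d (- v + (v + x)) \<le> (1 / 2) ^ n + d (v + x)" using v by (intro step) auto
      ultimately show ?thesis using n by (simp add: f_def)
    qed
    moreover have "open (W n \<inter> uminus -` W n)"
      by (intro open_Int open_vimage W(1) continuous_intros)
    ultimately show "\<exists>V. open V \<and> 0 \<in> V \<and> (\<forall>v\<in>V. \<forall>x. \<bar>f (v + x) - f x\<bar> < e)"
      using W(2) by (intro exI[of _ "W n \<inter> uminus -` W n"]) auto
  qed
  moreover have "\<exists>t\<in>T. \<exists>v\<in>S. x = v + t" if "f x \<noteq> 0" for x
    using that d1[of x] by (intro dS) (simp add: f_def)
  ultimately show ?thesis using that[of f] d0 d1 dT by (auto simp: f_def)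
qed

section \<open>From invariant means to matchings\<close>

definition left_invariant_mean :: "(('a::topological_group_add \<Rightarrow> real) \<Rightarrow> real) \<Rightarrow> bool"
  where "left_invariant_mean m \<longleftrightarrow>
      (\<forall>f\<in>UC_b. \<forall>h\<in>UC_b. m (\<lambda>x. f x + h x) = m f + m h) \<and>
      (\<forall>c. \<forall>f\<in>UC_b. m (\<lambda>x. c * f x) = c * m f) \<and>
      (\<forall>f\<in>UC_b. (INF x. f x) \<le> m f \<and> m f \<le> (SUP x. f x)) \<and>
      (\<forall>f\<in>UC_b. \<forall>g. m (f \<circ> (\<lambda>x. g + x)) = m f)"

lemma amenable_iff: "amenable TYPE('a::topological_group_add) \<longleftrightarrow> (\<exists>m :: ('a \<Rightarrow> real) \<Rightarrow> real. left_invariant_mean m)"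
  by (simp add: amenable_def left_invariant_mean_def)

lemma
  assumes "left_invariant_mean m" "f \<in> UC_b"
  shows mean_add: "h \<in> UC_b \<Longrightarrow> m (\<lambda>x. f x + h x) = m f + m h"
    and mean_scale: "m (\<lambda>x. c * f x) = c * m f"
    and mean_ge_INF: "(INF x. f x) \<le> m f"
    and mean_ltranslate: "m (\<lambda>x. f (g + x)) = m f"
  using assms unfolding left_invariant_mean_def comp_def by simp_all

lemma mean_zero: "left_invariant_mean m \<Longrightarrow> m (\<lambda>x. 0) = 0"
  using mean_scale[OF _ UC_b_const[of 0], of m 0] by simp

lemma mean_linear_combination:
  assumes m: "left_invariant_mean m" and "H \<subseteq> UC_b"
  shows "m (\<lambda>x. \<Sum>h\<in>H. c h * h x) = (\<Sum>h\<in>H. c h * m h)"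
  using assms(2)
proof (induction H rule: infinite_finite_induct)
  case (insert h H)
  have "(\<lambda>x. c h * h x) \<in> UC_b" "(\<lambda>x. \<Sum>h\<in>H. c h * h x) \<in> UC_b"
    using insert.prems by (auto intro!: UC_b_scale UC_b_sum)
  then have "m (\<lambda>x. c h * h x + (\<Sum>h\<in>H. c h * h x)) = m (\<lambda>x. c h * h x) + m (\<lambda>x. \<Sum>h\<in>H. c h * h x)"
    by (rule mean_add[OF m])
  moreover have "m (\<lambda>x. c h * h x) = c h * m h"
    using insert.prems by (intro mean_scale[OF m]) auto
  ultimately show ?case using insert by simp
next
  case empty
  then show ?case using mean_zero[OF m] by simp
next
  case (infinite H)
  then show ?case using mean_zero[OF m] by simp
qed

text \<open>
  If the mean kills each \<open>h\<close> in \<open>H\<close>, points can be added greedily so that the vector of the sums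
  \<open>\<Sum>x\<in>F. h x\<close> grows only like the square root of \<open>card F\<close>: the mean also kills the linear combination
  of \<open>H\<close> whose coefficients are the current sums, so at some point the next increment has almost
  nonpositive inner product with the current vector. The admissible points form an open set, which
  is infinite, so the new point can be chosen outside \<open>F\<close>.
\<close>

lemma greedy_sums:
  fixes m :: "('a::{topological_group_add, t2_space} \<Rightarrow> real) \<Rightarrow> real"
  assumes nd: "\<not> (\<forall>A :: 'a set. open A)"
    and m: "left_invariant_mean m" and H: "finite H" "H \<subseteq> UC_b" "\<And>h. h \<in> H \<Longrightarrow> m h = 0"
  obtains M where "\<And>n. \<exists>F. finite F \<and> card F = n \<and> (\<Sum>h\<in>H. (\<Sum>x\<in>F. h x)\<^sup>2) \<le> real n * M"
proof -
  obtain B where B: "\<And>h x. h \<in> H \<Longrightarrow> \<bar>h x\<bar> \<le> B h"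
    using H(2) UC_b_bounded by (metis subsetD)
  \<comment> \<open>In each step the mixed term contributes at most \<open>2\<close> and the new point its squared length.\<close>
  define M where "M = 2 + (\<Sum>h\<in>H. (B h)\<^sup>2)"
  have "\<exists>F. finite F \<and> card F = n \<and> (\<Sum>h\<in>H. (\<Sum>x\<in>F. h x)\<^sup>2) \<le> real n * M" for n
  proof (induction n)
    case 0
    then show ?case by (intro exI[of _ "{}"]) simp
  next
    case (Suc n)
    then obtain F where F: "finite F" "card F = n" "(\<Sum>h\<in>H. (\<Sum>x\<in>F. h x)\<^sup>2) \<le> real n * M" by blast
    define s where "s h = (\<Sum>x\<in>F. h x)" for h :: "'a \<Rightarrow> real"
    define k where "k x = (\<Sum>h\<in>H. s h * h x)" for x
    have k: "k \<in> UC_b" unfolding k_def using H(2) by (intro UC_b_sum UC_b_scale) auto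
    have "m k = 0" unfolding k_def using mean_linear_combination[OF m H(2), of s] H(3) by simp
    then have "(INF x. k x) < 1" using mean_ge_INF[OF m k] by linarith
    then obtain x0 where "k x0 < 1" using UC_b_bdd(2)[OF k] by (auto simp: cINF_less_iff)
    then have "infinite {x. k x < 1}"
      using nondiscrete_open_infinite[OF nd UC_b_open_less[OF k, of 1]] by blast
    then have "infinite ({x. k x < 1} - F)" using F(1) by (rule Diff_infinite_finite[rotated])
    then obtain x where x: "k x < 1" "x \<notin> F"
      by (metis (mono_tags, lifting) DiffE ex_in_conv finite.emptyI mem_Collect_eq)
    have "(\<Sum>h\<in>H. (\<Sum>x\<in>insert x F. h x)\<^sup>2) = (\<Sum>h\<in>H. (s h)\<^sup>2 + 2 * (s h * h x) + (h x)\<^sup>2)"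
      using F(1) x(2) by (intro sum.cong refl) (simp add: s_def power2_eq_square algebra_simps)
    also have "\<dots> = (\<Sum>h\<in>H. (s h)\<^sup>2) + 2 * k x + (\<Sum>h\<in>H. (h x)\<^sup>2)"
      by (simp add: sum.distrib k_def sum_distrib_left)
    also have "\<dots> \<le> real n * M + 2 * 1 + (\<Sum>h\<in>H. (B h)\<^sup>2)"
    proof (intro add_mono)
      show "(\<Sum>h\<in>H. (s h)\<^sup>2) \<le> real n * M" using F(3) by (simp add: s_def)
      show "2 * k x \<le> 2 * 1" using x(1) by simp
      show "(\<Sum>h\<in>H. (h x)\<^sup>2) \<le> (\<Sum>h\<in>H. (B h)\<^sup>2)"
        using B by (intro sum_mono) (metis abs_ge_zero power2_abs power_mono)
    qed
    also have "\<dots> = real (Suc n) * M" by (simp add: M_def algebra_simps)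
    finally show ?case using F x(2) by (intro exI[of _ "insert x F"]) auto
  qed
  then show ?thesis using that by blast
qed

text \<open>
  Apply the greedy choice to the differences \<open>f(g + x) - f(x)\<close>, which an invariant mean kills: sums of
  order \<open>sqrt n\<close> over \<open>n\<close> points are negligible against \<open>e * n\<close>.
\<close>

lemma approximately_invariant_set:
  fixes m :: "('a::{topological_group_add, t2_space} \<Rightarrow> real) \<Rightarrow> real" and E :: "'a set"
  assumes nd: "\<not> (\<forall>A :: 'a set. open A)"
    and m: "left_invariant_mean m" and H: "finite H" "H \<subseteq> UC_b" and E: "finite E" and e: "e > 0"
  obtains F where "finite F" "F \<noteq> {}"
    "\<And>f g. f \<in> H \<Longrightarrow> g \<in> E \<Longrightarrow> \<bar>(\<Sum>x\<in>F. f (g + x)) - (\<Sum>x\<in>F. f x)\<bar> \<le> e * real (card F)"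
proof -
  define dif :: "('a \<Rightarrow> real) \<times> 'a \<Rightarrow> 'a \<Rightarrow> real" where "dif = (\<lambda>(f, g) x. f (g + x) + (-1) * f x)"
  define H' where "H' = dif ` (H \<times> E)"
  have "dif (f, g) \<in> UC_b \<and> m (dif (f, g)) = 0" if "f \<in> H" for f g
  proof -
    have f: "f \<in> UC_b" using that H by blast
    have tr: "(\<lambda>x. f (g + x)) \<in> UC_b" and sc: "(\<lambda>x. (-1) * f x) \<in> UC_b"
      using UC_b_ltranslate[OF f, of g] UC_b_scale[OF f, of "-1"] by (simp_all add: comp_def)
    have "m (\<lambda>x. f (g + x) + (-1) * f x) = m (\<lambda>x. f (g + x)) + m (\<lambda>x. (-1) * f x)"
      by (rule mean_add[OF m tr sc])
    also have "m (\<lambda>x. f (g + x)) = m f"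
      by (rule mean_ltranslate[OF m f])
    also have "m (\<lambda>x. (-1) * f x) = (-1) * m f"
      by (rule mean_scale[OF m f])
    finally show ?thesis using UC_b_add[OF tr sc] by (simp add: dif_def)
  qed
  then have H': "finite H'" "H' \<subseteq> UC_b" "\<And>h. h \<in> H' \<Longrightarrow> m h = 0"
    using H(1) E by (auto simp: H'_def)
  obtain M where M: "\<And>n. \<exists>F. finite F \<and> card F = n \<and> (\<Sum>h\<in>H'. (\<Sum>x\<in>F. h x)\<^sup>2) \<le> real n * M"
    using greedy_sums[OF nd m H'] by blast
  obtain n where n: "M / e\<^sup>2 < real n" "n > 0"
  proof -
    obtain n where "M / e\<^sup>2 < real n" using reals_Archimedean2 by blast
    then have "M / e\<^sup>2 < real (Suc n)" by simp
    then show ?thesis using that by blast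
  qed
  obtain F where F: "finite F" "card F = n" "(\<Sum>h\<in>H'. (\<Sum>x\<in>F. h x)\<^sup>2) \<le> real n * M" using M by blast
  show ?thesis
  proof (rule that[OF F(1)])
    show "F \<noteq> {}" using F(2) n(2) by auto
    fix f g assume "f \<in> H" "g \<in> E"
    then have h: "dif (f, g) \<in> H'" by (auto simp: H'_def)
    have "(\<Sum>x\<in>F. dif (f, g) x)\<^sup>2 \<le> (\<Sum>h\<in>H'. (\<Sum>x\<in>F. h x)\<^sup>2)"
      by (rule member_le_sum[OF h _ H'(1)]) simp
    also have "\<dots> \<le> real n * M" by (rule F(3))
    also have "\<dots> \<le> real n * (e\<^sup>2 * real n)"
      using n(1) e by (intro mult_left_mono) (auto simp: field_simps)
    also have "\<dots> = (e * real n)\<^sup>2" by (simp add: power2_eq_square)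
    finally have "\<bar>\<Sum>x\<in>F. dif (f, g) x\<bar> \<le> e * real n"
      using e by (simp add: abs_le_square_iff[symmetric])
    then show "\<bar>(\<Sum>x\<in>F. f (g + x)) - (\<Sum>x\<in>F. f x)\<bar> \<le> e * real (card F)"
      using F(2) by (simp add: dif_def sum_subtractf)
  qed
qed

lemma sum_ltranslate:
  "(\<Sum>y\<in>ltranslate g F. f y) = (\<Sum>x\<in>F. f (g + x))"
  unfolding ltranslate_def by (subst sum.reindex) auto

text \<open>
  Hall's condition with defect is tested by Urysohn functions. For a subset \<open>S\<close> of \<open>F\<close> let \<open>T\<close> be the
  union of the members of a fine covering that meet \<open>S\<close>, and let \<open>f\<close> be \<open>1\<close> on \<open>T\<close> and vanish off a small
  neighborhood of \<open>T\<close>, all of whose points are close to \<open>S\<close>. Then \<open>card S \<le> \<Sum>x\<in>F. f x\<close>, and the sum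
  of \<open>f\<close> over \<open>g + F\<close> is at most the number of possible partners of \<open>S\<close>. Only finitely many sets \<open>T\<close>
  occur, so one \<open>F\<close> is almost invariant for all the functions involved.
\<close>

lemma mean_imp_matching:
  fixes m :: "('a::{topological_group_add, t2_space} \<Rightarrow> real) \<Rightarrow> real" and E :: "'a set"
  assumes nd: "\<not> (\<forall>A :: 'a set. open A)"
    and m: "left_invariant_mean m" and E: "finite E" and \<U>: "\<U> \<in> fin_uniform_covers" and e: "e > 0"
  obtains F where "finite F" "F \<noteq> {}"
    "\<And>g. g \<in> E \<Longrightarrow> (1 - e) * real (card F) \<le> real (matching_number F (ltranslate g F) \<U>)"
proof -
  obtain \<W> where \<W>: "\<W> \<in> fin_uniform_covers" "\<U> \<preceq> \<W>"
    "\<And>W. W \<in> \<W> \<Longrightarrow> \<exists>U\<in>\<U>. \<forall>W'\<in>\<W>. W \<inter> W' \<noteq> {} \<longrightarrow> W \<union> W' \<subseteq> U"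
    using star_refinement[OF \<U>] by blast
  obtain V where V: "finite \<W>" "open V" "0 \<in> V" "\<And>x. \<exists>U\<in>\<W>. \<forall>v\<in>V. v + x \<in> U"
    using fin_uniform_coversE[OF \<W>(1)] by blast
  have "\<exists>f. f \<in> UC_b \<and> (\<forall>x. 0 \<le> f x) \<and> (\<forall>x. f x \<le> 1) \<and> (\<forall>x\<in>T. f x = 1) \<and>
      (\<forall>x. f x \<noteq> 0 \<longrightarrow> (\<exists>t\<in>T. \<exists>v\<in>V. x = v + t))" for T
    using uniform_urysohn[OF V(2,3), of T] by metis
  then obtain u where u: "\<And>T. u T \<in> UC_b" "\<And>T x. 0 \<le> u T x" "\<And>T x. u T x \<le> 1"
    "\<And>T x. x \<in> T \<Longrightarrow> u T x = 1" "\<And>T x. u T x \<noteq> 0 \<Longrightarrow> \<exists>t\<in>T. \<exists>v\<in>V. x = v + t"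
    by metis
  define H where "H = (\<lambda>\<T>. u (\<Union>\<T>)) ` Pow \<W>"
  have H: "finite H" "H \<subseteq> UC_b" using V(1) u(1) by (auto simp: H_def)
  obtain F where F: "finite F" "F \<noteq> {}"
    "\<And>f g. f \<in> H \<Longrightarrow> g \<in> E \<Longrightarrow> \<bar>(\<Sum>x\<in>F. f (g + x)) - (\<Sum>x\<in>F. f x)\<bar> \<le> e * real (card F)"
    using approximately_invariant_set[OF nd m H E e] by blast
  show ?thesis
  proof (rule that[OF F(1,2)])
    fix g assume g: "g \<in> E"
    define N where "N x = {y\<in>ltranslate g F. \<exists>U\<in>\<U>. {x, y} \<subseteq> U}" for x
    define d where "d = nat \<lfloor>e * real (card F)\<rfloor>"
    have fing: "finite (ltranslate g F)" using F(1) by (rule finite_ltranslate)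
    have hall: "card S \<le> card (\<Union>x\<in>S. N x) + d" if S: "S \<subseteq> F" for S
    proof -
      define \<T> where "\<T> = {W\<in>\<W>. W \<inter> S \<noteq> {}}"
      define f where "f = u (\<Union>\<T>)"
      have fH: "f \<in> H" by (auto simp: f_def H_def \<T>_def)
      have fS: "f x = 1" if "x \<in> S" for x
        unfolding f_def using fin_uniform_covers_covers[OF \<W>(1), of x] that
        by (intro u(4)) (auto simp: \<T>_def)
      have fN: "y \<in> (\<Union>x\<in>S. N x)" if y: "y \<in> ltranslate g F" "f y \<noteq> 0" for y
      proof -
        obtain t v where tv: "t \<in> \<Union>\<T>" "v \<in> V" "y = v + t" using u(5)[of "\<Union>\<T>" y] y(2) unfolding f_def by blast
        obtain W x where W: "W \<in> \<W>" "t \<in> W" "x \<in> W" "x \<in> S" using tv(1) by (auto simp: \<T>_def)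
        obtain W' where W': "W' \<in> \<W>" "\<forall>v\<in>V. v + t \<in> W'" using V(4) by blast
        obtain U where U: "U \<in> \<U>" "\<forall>W'\<in>\<W>. W \<inter> W' \<noteq> {} \<longrightarrow> W \<union> W' \<subseteq> U" using \<W>(3)[OF W(1)] by blast
        have "t \<in> W'" using W'(2) V(3) by force
        then have "W \<union> W' \<subseteq> U" using U(2) W'(1) W(2) by blast
        then have "{x, y} \<subseteq> U" using W(3) W'(2) tv by auto
        then show ?thesis using U(1) y(1) W(4) by (auto simp: N_def)
      qed
      have finN: "(\<Union>x\<in>S. N x) \<subseteq> ltranslate g F" by (auto simp: N_def)
      have "real (card S) = (\<Sum>x\<in>S. f x)" using fS by simp
      also have "\<dots> \<le> (\<Sum>x\<in>F. f x)"
        using S F(1) u(2) by (intro sum_mono2) (auto simp: f_def)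
      also have "\<dots> \<le> (\<Sum>x\<in>F. f (g + x)) + e * real (card F)"
        using F(3)[OF fH g] by (simp add: abs_le_iff)
      also have "(\<Sum>x\<in>F. f (g + x)) = (\<Sum>y\<in>ltranslate g F. f y)"
        by (rule sum_ltranslate[symmetric])
      also have "\<dots> = (\<Sum>y\<in>(\<Union>x\<in>S. N x). f y)"
      proof (rule sum.mono_neutral_right[OF fing finN])
        show "\<forall>y\<in>ltranslate g F - (\<Union>x\<in>S. N x). f y = 0" using fN by blast
      qed
      also have "\<dots> \<le> (\<Sum>y\<in>(\<Union>x\<in>S. N x). 1)"
        using u(3) by (intro sum_mono) (auto simp: f_def)
      finally have "real (card S) - real (card (\<Union>x\<in>S. N x)) \<le> e * real (card F)" by simp
      then show ?thesis unfolding d_def by linarith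
    qed
    have finN: "finite (N x)" for x by (rule finite_subset[OF _ fing]) (auto simp: N_def)
    obtain D \<phi> where D: "D \<subseteq> F" "card F \<le> card D + d" "inj_on \<phi> D" "\<And>x. x \<in> D \<Longrightarrow> \<phi> x \<in> N x"
      using hall_defect[OF F(1) finN hall] by blast
    have "card D \<le> matching_number F (ltranslate g F) \<U>"
      using D(4) by (intro matching_number_ge[OF F(1) D(1,3)]) (auto simp: N_def)
    moreover have "real d \<le> e * real (card F)" unfolding d_def using e by (simp add: of_nat_nat)
    ultimately show "(1 - e) * real (card F) \<le> real (matching_number F (ltranslate g F) \<U>)"
      using D(2) by (simp add: algebra_simps)
  qed
qed

section \<open>From matchings to invariant means\<close>

text \<open>
  Compare the sums over \<open>F\<close> and \<open>g + F\<close>: matched points contribute at most the oscillation of \<open>f\<close> on the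
  covering, and the few unmatched points at most the bound of \<open>f\<close> each.
\<close>

lemma matching_imp_approximately_invariant:
  fixes H :: "('a::topological_group_add \<Rightarrow> real) set"
  assumes match: "\<And>E \<U> e. finite E \<Longrightarrow> \<U> \<in> fin_uniform_covers \<Longrightarrow> e > 0 \<Longrightarrow>
      \<exists>F :: 'a set. finite F \<and> F \<noteq> {} \<and>
        (\<forall>g\<in>E. (1 - e) * real (card F) \<le> real (matching_number F (ltranslate g F) \<U>))"
    and H: "finite H" "H \<subseteq> UC_b" and E: "finite E" and e: "e > (0::real)"
  obtains F :: "'a set" where "finite F" "F \<noteq> {}"
    "\<And>f g. f \<in> H \<Longrightarrow> g \<in> E \<Longrightarrow> \<bar>(\<Sum>x\<in>F. f (g + x)) - (\<Sum>x\<in>F. f x)\<bar> \<le> e * real (card F)"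
proof -
  obtain B where B: "B \<ge> 0" "\<And>f x. f \<in> H \<Longrightarrow> \<bar>f x\<bar> \<le> B"
  proof -
    obtain b where b: "\<And>f x. f \<in> H \<Longrightarrow> \<bar>f x\<bar> \<le> b f" using H(2) UC_b_bounded by (metis subsetD)
    have b0: "0 \<le> b f" if "f \<in> H" for f using b[OF that] abs_ge_zero order_trans by blast
    have "\<bar>f x\<bar> \<le> (\<Sum>f\<in>H. b f)" if "f \<in> H" for f x
      using b[OF that, of x] member_le_sum[OF that, of b] b0 H(1) by force
    then show ?thesis using that[of "\<Sum>f\<in>H. b f"] b0 by (simp add: sum_nonneg)
  qed
  obtain \<U> where \<U>: "\<U> \<in> fin_uniform_covers"
    "\<And>f U x y. f \<in> H \<Longrightarrow> U \<in> \<U> \<Longrightarrow> x \<in> U \<Longrightarrow> y \<in> U \<Longrightarrow> \<bar>f x - f y\<bar> \<le> e / 2"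
    using UC_b_finite_small_oscillation_cover[OF H half_gt_zero[OF e]] by blast
  \<comment> \<open>A fraction \<open>e'\<close> of unmatched points on either side costs at most \<open>2 * B * e'\<close>; the summand \<open>1\<close>
    covers the case \<open>B = 0\<close>.\<close>
  define e' where "e' = e / (4 * (B + 1))"
  have e': "e' > 0" using e B(1) by (simp add: e'_def)
  have Be: "2 * B * e' \<le> e / 2"
  proof -
    have "2 * B * e' = (e / 2) * (B / (B + 1))" using B(1) by (simp add: e'_def field_simps)
    also have "\<dots> \<le> (e / 2) * 1" using B(1) e by (intro mult_left_mono) auto
    finally show ?thesis by simp
  qed
  obtain F where F: "finite F" "F \<noteq> {}"
    "\<And>g. g \<in> E \<Longrightarrow> (1 - e') * real (card F) \<le> real (matching_number F (ltranslate g F) \<U>)"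
    using match[OF E \<U>(1) e'] by blast
  show ?thesis
  proof (rule that[OF F(1,2)])
    fix f g assume f: "f \<in> H" and g: "g \<in> E"
    obtain D \<phi> where D: "D \<subseteq> F" "inj_on \<phi> D" "\<phi> ` D \<subseteq> ltranslate g F"
      "\<And>x. x \<in> D \<Longrightarrow> \<exists>U\<in>\<U>. {x, \<phi> x} \<subseteq> U" "card D = matching_number F (ltranslate g F) \<U>"
      using matching_number_attained[OF F(1)] by blast
    have fin: "finite D" "finite (ltranslate g F)"
      using D(1) F(1) finite_subset finite_ltranslate by blast+
    define r where "r = real (card F) - real (card D)"
    have r: "r \<le> e' * real (card F)" using F(3)[OF g] D(5) by (simp add: r_def algebra_simps)
    have bnd: "\<bar>\<Sum>x\<in>A. f x\<bar> \<le> B * real (card A)" for A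
    proof -
      have "\<bar>\<Sum>x\<in>A. f x\<bar> \<le> (\<Sum>x\<in>A. \<bar>f x\<bar>)" by (rule sum_abs)
      also have "\<dots> \<le> (\<Sum>x\<in>A. B)" using B(2)[OF f] by (intro sum_mono)
      finally show ?thesis by (simp add: mult.commute)
    qed
    have 1: "(\<Sum>x\<in>F. f x) = (\<Sum>x\<in>D. f x) + (\<Sum>x\<in>F - D. f x)"
      using D(1) F(1) by (metis sum.subset_diff add.commute)
    have 2: "(\<Sum>x\<in>F. f (g + x)) = (\<Sum>x\<in>D. f (\<phi> x)) + (\<Sum>x\<in>ltranslate g F - \<phi> ` D. f x)"
    proof -
      have "(\<Sum>x\<in>F. f (g + x)) = (\<Sum>x\<in>\<phi> ` D. f x) + (\<Sum>x\<in>ltranslate g F - \<phi> ` D. f x)"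
        unfolding sum_ltranslate[symmetric] using D(3) fin(2) by (metis sum.subset_diff add.commute)
      then show ?thesis using D(2) by (simp add: sum.reindex)
    qed
    have "\<bar>(\<Sum>x\<in>D. f (\<phi> x)) - (\<Sum>x\<in>D. f x)\<bar> \<le> (\<Sum>x\<in>D. \<bar>f (\<phi> x) - f x\<bar>)"
      by (simp add: sum_abs flip: sum_subtractf)
    also have "\<dots> \<le> (\<Sum>x\<in>D. e / 2)"
      using D(4) \<U>(2)[OF f] by (intro sum_mono) (metis insert_subset)
    also have "\<dots> \<le> e / 2 * real (card F)"
      using card_mono[OF F(1) D(1)] e by (simp add: mult_left_mono)
    finally have 3: "\<bar>(\<Sum>x\<in>D. f (\<phi> x)) - (\<Sum>x\<in>D. f x)\<bar> \<le> e / 2 * real (card F)" .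
    have "real (card (F - D)) = r"
      using D(1) fin(1) card_mono[OF F(1) D(1)] by (simp add: card_Diff_subset r_def of_nat_diff)
    then have 4: "\<bar>\<Sum>x\<in>F - D. f x\<bar> \<le> B * r" using bnd[of "F - D"] by simp
    have "real (card (ltranslate g F - \<phi> ` D)) = r"
      using D(2,3) fin card_mono[OF F(1) D(1)]
      by (simp add: card_Diff_subset card_image card_ltranslate r_def of_nat_diff)
    then have 5: "\<bar>\<Sum>x\<in>ltranslate g F - \<phi> ` D. f x\<bar> \<le> B * r" using bnd[of "ltranslate g F - \<phi> ` D"] by simp
    have "2 * (B * r) \<le> 2 * (B * (e' * real (card F)))"
      using B(1) r by (intro mult_left_mono) auto
    also have "\<dots> = 2 * B * e' * real (card F)" by simp
    also have "\<dots> \<le> e / 2 * real (card F)" using Be by (intro mult_right_mono) auto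
    finally have "2 * (B * r) \<le> e / 2 * real (card F)" .
    then show "\<bar>(\<Sum>x\<in>F. f (g + x)) - (\<Sum>x\<in>F. f x)\<bar> \<le> e * real (card F)"
      using 1 2 3 4 5 by linarith
  qed
qed

lemma compact_Pi_UNIV:
  fixes B :: "'i \<Rightarrow> 'b::topological_space set"
  assumes "\<And>i. compact (B i)"
  shows "compact {m. \<forall>i. m i \<in> B i}"
proof -
  have "compactin (product_topology (\<lambda>i. euclidean) UNIV) (PiE UNIV B)"
    using assms by (simp add: compactin_PiE)
  moreover have "PiE UNIV B = {m. \<forall>i. m i \<in> B i}" by (auto simp: PiE_iff)
  ultimately show ?thesis by (simp add: euclidean_product_topology)
qed

text \<open>
  By Tychonoff's theorem the linear functionals between infimum and supremum form a compact set for
  pointwise convergence. The closed conditions of invariance up to \<open>e\<close>, for a function \<open>f\<close> and an element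
  \<open>g\<close>, have the finite intersection property in this set, as averages over finite sets show.
\<close>

lemma approximately_invariant_imp_mean:
  assumes approx: "\<And>H E e. finite H \<Longrightarrow> H \<subseteq> UC_b \<Longrightarrow> finite E \<Longrightarrow> e > 0 \<Longrightarrow>
      \<exists>F :: 'a::topological_group_add set. finite F \<and> F \<noteq> {} \<and>
        (\<forall>f\<in>H. \<forall>g\<in>E. \<bar>(\<Sum>x\<in>F. f (g + x)) - (\<Sum>x\<in>F. f x)\<bar> \<le> e * real (card F))"
  shows "\<exists>m :: ('a \<Rightarrow> real) \<Rightarrow> real. left_invariant_mean m"
proof -
  \<comment> \<open>Outside \<open>UC_b\<close> the value is pinned to \<open>0\<close>, so that all factors of the product are compact.\<close>
  define B where "B f = (if f \<in> UC_b then {(INF x. f x)..(SUP x. f x)} else {0})" for f :: "'a \<Rightarrow> real"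
  define K where "K = {m. \<forall>f. m f \<in> B f} \<inter>
    {m. \<forall>f\<in>UC_b. \<forall>h\<in>UC_b. m (\<lambda>x. f x + h x) = m f + m h} \<inter>
    {m. \<forall>c. \<forall>f\<in>UC_b. m (\<lambda>x. c * f x) = c * m f}"
  have coord: "continuous_on UNIV (\<lambda>m :: ('a \<Rightarrow> real) \<Rightarrow> real. m f)" for f
    by (rule continuous_on_product_coordinates)
  have "compact {m. \<forall>f. m f \<in> B f}" by (rule compact_Pi_UNIV) (simp add: B_def)
  moreover have "closed {m :: ('a \<Rightarrow> real) \<Rightarrow> real. \<forall>f\<in>UC_b. \<forall>h\<in>UC_b. m (\<lambda>x. f x + h x) = m f + m h}"
  proof -
    have "{m :: ('a \<Rightarrow> real) \<Rightarrow> real. \<forall>f\<in>UC_b. \<forall>h\<in>UC_b. m (\<lambda>x. f x + h x) = m f + m h}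
      = (\<Inter>f\<in>UC_b. \<Inter>h\<in>UC_b. {m. m (\<lambda>x. f x + h x) = m f + m h})" by auto
    then show ?thesis
      by (simp only:) (intro closed_INT ballI closed_Collect_eq continuous_on_add coord)
  qed
  moreover have "closed {m :: ('a \<Rightarrow> real) \<Rightarrow> real. \<forall>c. \<forall>f\<in>UC_b. m (\<lambda>x. c * f x) = c * m f}"
  proof -
    have "{m :: ('a \<Rightarrow> real) \<Rightarrow> real. \<forall>c. \<forall>f\<in>UC_b. m (\<lambda>x. c * f x) = c * m f}
      = (\<Inter>c. \<Inter>f\<in>UC_b. {m. m (\<lambda>x. c * f x) = c * m f})" by auto
    then show ?thesis
      by (simp only:) (intro closed_INT ballI closed_Collect_eq continuous_on_mult continuous_on_const coord)
  qed
  ultimately have compK: "compact K" unfolding K_def by (intro compact_Int_closed)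
  define C where "C = (\<lambda>(f, g, e). {m. \<bar>m (f \<circ> (\<lambda>x. g + x)) - m f\<bar> \<le> e} :: (('a \<Rightarrow> real) \<Rightarrow> real) set)"
  define Q where "Q = (UC_b :: ('a \<Rightarrow> real) set) \<times> (UNIV :: 'a set) \<times> {0 :: real<..}"
  have "K \<inter> (\<Inter>q\<in>Q. C q) \<noteq> {}"
  proof (rule compact_imp_fip_image[OF compK])
    show "closed (C q)" if "q \<in> Q" for q
      unfolding C_def
      by (cases q) (auto intro!: closed_Collect_le continuous_intros coord)
  next
    fix Q' assume Q': "finite Q'" "Q' \<subseteq> Q"
    define e where "e = Min (insert 1 ((\<lambda>(f, g, e). e) ` Q'))"
    have e: "e > 0" unfolding e_def using Q' by (subst Min_gr_iff) (auto simp: Q_def)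
    have e_le: "e \<le> e'" if "(f, g, e') \<in> Q'" for f g e'
      unfolding e_def using Q'(1) that by (intro Min_le) (auto intro: rev_image_eqI)
    define H where "H = fst ` Q'"
    define E where "E = (fst \<circ> snd) ` Q'"
    obtain F where F: "finite F" "F \<noteq> {}"
      "\<And>f g. f \<in> H \<Longrightarrow> g \<in> E \<Longrightarrow> \<bar>(\<Sum>x\<in>F. f (g + x)) - (\<Sum>x\<in>F. f x)\<bar> \<le> e * real (card F)"
    proof -
      have "finite H" "H \<subseteq> UC_b" "finite E" using Q' by (auto simp: H_def E_def Q_def)
      from approx[OF this e] show ?thesis using that by blast
    qed
    have cF: "real (card F) > 0" using F by (simp add: card_gt_0_iff)
    define m where "m f = (if f \<in> UC_b then (\<Sum>x\<in>F. f x) / real (card F) else 0)" for f :: "'a \<Rightarrow> real"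
    have "m f \<in> B f" for f
    proof (cases "f \<in> UC_b")
      case True
      have "(\<Sum>x\<in>F. (INF x. f x)) \<le> (\<Sum>x\<in>F. f x)" "(\<Sum>x\<in>F. f x) \<le> (\<Sum>x\<in>F. (SUP x. f x))"
        using UC_b_bdd[OF True] by (intro sum_mono cINF_lower cSUP_upper; simp)+
      then show ?thesis using True cF by (simp add: B_def m_def field_simps)
    qed (simp add: B_def m_def)
    moreover have "m (\<lambda>x. f x + h x) = m f + m h" if "f \<in> UC_b" "h \<in> UC_b" for f h
      using that UC_b_add[OF that] by (simp add: m_def sum.distrib add_divide_distrib)
    moreover have "m (\<lambda>x. c * f x) = c * m f" if "f \<in> UC_b" for c f
      using that UC_b_scale[OF that, of c] by (simp add: m_def sum_distrib_left)
    ultimately have "m \<in> K" by (simp add: K_def)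
    moreover have "m \<in> C q" if q: "q \<in> Q'" for q
    proof -
      obtain f g e' where fge: "q = (f, g, e')" by (cases q)
      have f: "f \<in> UC_b" using q Q'(2) by (auto simp: Q_def fge)
      have "f \<in> H" "g \<in> E" using q by (force simp: H_def E_def fge)+
      have "\<bar>m (f \<circ> (\<lambda>x. g + x)) - m f\<bar> = \<bar>(\<Sum>x\<in>F. f (g + x)) - (\<Sum>x\<in>F. f x)\<bar> / real (card F)"
        using f UC_b_ltranslate[OF f, of g] cF by (simp add: m_def abs_divide flip: diff_divide_distrib)
      also have "\<dots> \<le> e" using F(3)[OF \<open>f \<in> H\<close> \<open>g \<in> E\<close>] cF by (simp add: divide_le_eq)
      also have "\<dots> \<le> e'" using e_le q fge by blast
      finally show ?thesis by (simp add: C_def fge)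
    qed
    ultimately show "K \<inter> (\<Inter>q\<in>Q'. C q) \<noteq> {}" by blast
  qed
  then obtain m where m: "m \<in> K" "\<And>q. q \<in> Q \<Longrightarrow> m \<in> C q" by blast
  have "m (f \<circ> (\<lambda>x. g + x)) = m f" if f: "f \<in> UC_b" for f g
  proof -
    have "\<bar>m (f \<circ> (\<lambda>x. g + x)) - m f\<bar> \<le> 0 + e" if "e > 0" for e
      using m(2)[of "(f, g, e)"] f that by (simp add: Q_def C_def)
    then have "\<bar>m (f \<circ> (\<lambda>x. g + x)) - m f\<bar> \<le> 0" by (rule field_le_epsilon)
    then show ?thesis by simp
  qed
  moreover have "(INF x. f x) \<le> m f \<and> m f \<le> (SUP x. f x)" if "f \<in> UC_b" for f
  proof -
    have "m f \<in> B f" using m(1) by (simp add: K_def)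
    then show ?thesis using that by (simp add: B_def)
  qed
  ultimately show ?thesis using m(1) unfolding left_invariant_mean_def K_def by blast
qed

lemma amenable_iff_mean_matching:
  assumes nd: "\<not> (\<forall>A :: 'a::{topological_group_add, t2_space} set. open A)"
  shows "amenable TYPE('a) \<longleftrightarrow> mean_topological_matching_number TYPE('a) = 1"
proof
  assume "amenable TYPE('a)"
  then obtain m :: "('a \<Rightarrow> real) \<Rightarrow> real" where m: "left_invariant_mean m" by (auto simp: amenable_iff)
  have "1 \<le> mean_topological_matching_number TYPE('a)"
    unfolding mean_topological_matching_number_def
  proof (rule INF_greatest, rule INF_greatest, rule ereal_le_epsilon2)
    fix E :: "'a set" and \<U> :: "'a set set" and e :: real
    assume "E \<in> {E. finite E}" and \<U>: "\<U> \<in> fin_uniform_covers" and e: "0 < e"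
    then have E: "finite E" by simp
    obtain F where F: "finite F" "F \<noteq> {}"
      "\<And>g. g \<in> E \<Longrightarrow> (1 - e) * real (card F) \<le> real (matching_number F (ltranslate g F) \<U>)"
      using mean_imp_matching[OF nd m E \<U> e] by blast
    have "card F > 0" using F by (simp add: card_gt_0_iff)
    then have "ereal (1 - e) \<le> (INF g\<in>E. ereal (real (matching_number F (ltranslate g F) \<U>) / real (card F)))"
      using F(3) by (intro INF_greatest) (simp add: le_divide_eq)
    also have "\<dots> \<le> (SUP F\<in>{F. finite F \<and> F \<noteq> {}}.
        INF g\<in>E. ereal (real (matching_number F (ltranslate g F) \<U>) / real (card F)))"
      using F by (intro SUP_upper) auto
    finally have "ereal (1 - e) + ereal e \<le> (SUP F\<in>{F. finite F \<and> F \<noteq> {}}.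
        INF g\<in>E. ereal (real (matching_number F (ltranslate g F) \<U>) / real (card F))) + ereal e"
      by (rule add_right_mono)
    then show "1 \<le> (SUP F\<in>{F. finite F \<and> F \<noteq> {}}.
        INF g\<in>E. ereal (real (matching_number F (ltranslate g F) \<U>) / real (card F))) + ereal e"
      by (simp add: one_ereal_def)
  qed
  moreover obtain r where "mean_topological_matching_number TYPE('a) = ereal r" "r \<le> 1"
    using mean_matching_number_bounds by blast
  ultimately show "mean_topological_matching_number TYPE('a) = 1" by (simp add: one_ereal_def)
next
  assume one: "mean_topological_matching_number TYPE('a) = 1"
  have match: "\<exists>F :: 'a set. finite F \<and> F \<noteq> {} \<and>
        (\<forall>g\<in>E. (1 - e) * real (card F) \<le> real (matching_number F (ltranslate g F) \<U>))"
    if E: "finite E" and \<U>: "\<U> \<in> fin_uniform_covers" and e: "e > 0" for E \<U> e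
  proof -
    have "1 \<le> (SUP F\<in>{F. finite F \<and> F \<noteq> {}}.
        INF g\<in>E. ereal (real (matching_number F (ltranslate g F) \<U>) / real (card F)))"
      unfolding one[symmetric] mean_topological_matching_number_def
      using E \<U> by (intro INF_lower2[of E] INF_lower2[of \<U>]) auto
    moreover have "ereal (1 - e) < 1" using e by (simp add: one_ereal_def)
    ultimately have "ereal (1 - e) < (SUP F\<in>{F. finite F \<and> F \<noteq> {}}.
        INF g\<in>E. ereal (real (matching_number F (ltranslate g F) \<U>) / real (card F)))"
      by (rule less_le_trans[rotated])
    then obtain F where F: "finite F" "F \<noteq> {}"
      and lt: "ereal (1 - e) < (INF g\<in>E. ereal (real (matching_number F (ltranslate g F) \<U>) / real (card F)))"
      unfolding less_SUP_iff by blast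
    have "card F > 0" using F by (simp add: card_gt_0_iff)
    then have "(1 - e) * real (card F) \<le> real (matching_number F (ltranslate g F) \<U>)" if "g \<in> E" for g
      using less_INF_D[OF lt that] by (simp add: less_divide_eq)
    then show ?thesis using F by blast
  qed
  have "\<exists>m :: ('a \<Rightarrow> real) \<Rightarrow> real. left_invariant_mean m"
  proof (rule approximately_invariant_imp_mean)
    fix H :: "('a \<Rightarrow> real) set" and E :: "'a set" and e :: real
    assume *: "finite H" "H \<subseteq> UC_b" "finite E" "e > 0"
    show "\<exists>F :: 'a set. finite F \<and> F \<noteq> {} \<and>
        (\<forall>f\<in>H. \<forall>g\<in>E. \<bar>(\<Sum>x\<in>F. f (g + x)) - (\<Sum>x\<in>F. f x)\<bar> \<le> e * real (card F))"
    proof (rule matching_imp_approximately_invariant[OF match *])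
      fix F :: "'a set"
      assume "finite F" "F \<noteq> {}"
        and "\<And>f g. f \<in> H \<Longrightarrow> g \<in> E \<Longrightarrow> \<bar>(\<Sum>x\<in>F. f (g + x)) - (\<Sum>x\<in>F. f x)\<bar> \<le> e * real (card F)"
      then show ?thesis by (intro exI[of _ F]) simp
    qed
  qed
  then show "amenable TYPE('a)" by (simp add: amenable_iff)
qed

section \<open>Amenability and complexity\<close>

theorem corollary6p10:
  assumes non_discrete: "\<not> (\<forall>A :: 'a::{topological_group_add, t2_space} set. open A)"
  shows "asymptotic_uniform_complexity TYPE('a) = 2 - mean_topological_matching_number TYPE('a) \<and>
    (amenable TYPE('a) \<longleftrightarrow> asymptotic_uniform_complexity TYPE('a) = 1)"
proof -
  obtain m where m: "mean_topological_matching_number TYPE('a) = ereal m"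
    using mean_matching_number_bounds by blast
  have "asymptotic_uniform_complexity TYPE('a) = ereal (2 - m)"
    using complexity_le[OF non_discrete m] complexity_ge[OF non_discrete m] by (rule antisym)
  moreover have "(2::ereal) = ereal 2" by simp
  ultimately have "asymptotic_uniform_complexity TYPE('a) = 2 - mean_topological_matching_number TYPE('a)"
    "asymptotic_uniform_complexity TYPE('a) = 1 \<longleftrightarrow> mean_topological_matching_number TYPE('a) = 1"
    unfolding m by (auto simp: one_ereal_def)
  then show ?thesis using amenable_iff_mean_matching[OF non_discrete] by simp
qed

end
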